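(* The following is provable in ZF (without the Axiom of Choice): $AC_{fin}^{\omega}$ implies that for any infinite locally finite connected graph $G=(V_G,E_G)$ and any finite graph $H=(V_H,E_H)$, if every finite subgraph of $G$ has a homomorphism into $H$, then $G$ has a homomorphism into $H$.
   Context: $AC_{fin}^{\omega}$: every denumerable (i.e. countably infinite) family of non-empty finite sets has a choice function. A graph is locally finite if every vertex has finite degree; it is connected if any two vertices are joined by a path of finite length. A homomorphism from $G=(V_G,E_G)$ to $H=(V_H,E_H)$ is a map $f:V_G\to V_H$ such that $\{v_1,v_2\}\in E_G$ implies $\{f(v_1),f(v_2)\}\in E_H$. *)

theory Defs
  imports Main
begin

text \<open>
  Isabelle/HOL has global choice built in, so provability in ZF without choice is expressed
  through a deep embedding: the first-order language of set theory with equality,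
  a Hilbert calculus for it, and the axioms of ZF.
\<close>

section \<open>First-order logic with membership and equality\<close>

text \<open>Variables are de Bruijn indices; the language has no other terms.\<close>

datatype fm = Mem nat nat | Eq nat nat | Fls | Imp fm fm | All fm

fun lift :: "(nat \<Rightarrow> nat) \<Rightarrow> nat \<Rightarrow> nat" where
  "lift r 0 = 0"
| "lift r (Suc i) = Suc (r i)"

primrec ren :: "(nat \<Rightarrow> nat) \<Rightarrow> fm \<Rightarrow> fm" where
  "ren r (Mem i j) = Mem (r i) (r j)"
| "ren r (Eq i j) = Eq (r i) (r j)"
| "ren r Fls = Fls"
| "ren r (Imp p q) = Imp (ren r p) (ren r q)"
| "ren r (All p) = All (ren (lift r) p)"

text \<open>\<open>inst t p\<close> removes the outermost binder position of \<open>p\<close>, putting the variable \<open>t\<close> in its place.\<close>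

definition inst :: "nat \<Rightarrow> fm \<Rightarrow> fm" where
  "inst t p = ren (case_nat t (\<lambda>i. i)) p"

text \<open>
  Because of the rule \<open>Gen\<close>, a free variable in a member of \<open>T\<close> counts as universally quantified.
\<close>

inductive proves :: "fm set \<Rightarrow> fm \<Rightarrow> bool" (infix "\<turnstile>" 5) for T :: "fm set" where
  Ax: "p \<in> T \<Longrightarrow> T \<turnstile> p"
| K: "T \<turnstile> Imp p (Imp q p)"
| S: "T \<turnstile> Imp (Imp p (Imp q r)) (Imp (Imp p q) (Imp p r))"
| DN: "T \<turnstile> Imp (Imp (Imp p Fls) Fls) p"
| AllInst: "T \<turnstile> Imp (All p) (inst t p)"
| AllDistr: "T \<turnstile> Imp (All (Imp p q)) (Imp (All p) (All q))"
| AllVac: "T \<turnstile> Imp p (All (ren Suc p))"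
| EqRefl: "T \<turnstile> Eq i i"
| EqSubst: "T \<turnstile> Imp (Eq i j) (Imp (inst i p) (inst j p))"
| MP: "T \<turnstile> Imp p q \<Longrightarrow> T \<turnstile> p \<Longrightarrow> T \<turnstile> q"
| Gen: "T \<turnstile> p \<Longrightarrow> T \<turnstile> All p"


section \<open>Formulas with named bound variables\<close>

text \<open>
  Formulas are written in higher-order abstract syntax. A value of type \<open>form\<close> yields a
  formula when given the number \<open>d\<close> of enclosing quantifiers. A bound variable is represented
  by its level, that is, by the number of quantifiers enclosing its own quantifier; under \<open>d\<close>
  quantifiers, level \<open>x\<close> has de Bruijn index \<open>d - Suc x\<close>. A sentence is obtained
  by applying a \<open>form\<close> to \<open>0\<close>.
\<close>

type_synonym form = "nat \<Rightarrow> fm"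

definition mem :: "nat \<Rightarrow> nat \<Rightarrow> form" (infix "\<^bold>\<in>" 50) where
  "(x \<^bold>\<in> y) = (\<lambda>d. Mem (d - Suc x) (d - Suc y))"

definition eql :: "nat \<Rightarrow> nat \<Rightarrow> form" (infix "\<^bold>=" 50) where
  "(x \<^bold>= y) = (\<lambda>d. Eq (d - Suc x) (d - Suc y))"

definition imp :: "form \<Rightarrow> form \<Rightarrow> form" (infixr "\<^bold>\<longrightarrow>" 25) where
  "(P \<^bold>\<longrightarrow> Q) = (\<lambda>d. Imp (P d) (Q d))"

definition neg :: "form \<Rightarrow> form" ("\<^bold>\<not> _" [40] 40) where
  "(\<^bold>\<not> P) = (\<lambda>d. Imp (P d) Fls)"

definition conj :: "form \<Rightarrow> form \<Rightarrow> form" (infixr "\<^bold>\<and>" 35) where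
  "(P \<^bold>\<and> Q) = (\<^bold>\<not> (P \<^bold>\<longrightarrow> \<^bold>\<not> Q))"

definition disj :: "form \<Rightarrow> form \<Rightarrow> form" (infixr "\<^bold>\<or>" 30) where
  "(P \<^bold>\<or> Q) = (\<^bold>\<not> P \<^bold>\<longrightarrow> Q)"

definition iff :: "form \<Rightarrow> form \<Rightarrow> form" (infixr "\<^bold>\<longleftrightarrow>" 25) where
  "(P \<^bold>\<longleftrightarrow> Q) = ((P \<^bold>\<longrightarrow> Q) \<^bold>\<and> (Q \<^bold>\<longrightarrow> P))"

definition all :: "(nat \<Rightarrow> form) \<Rightarrow> form" (binder "\<^bold>\<forall>" 10) where
  "all P = (\<lambda>d. All (P d (Suc d)))"

definition ex :: "(nat \<Rightarrow> form) \<Rightarrow> form" (binder "\<^bold>\<exists>" 10) where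
  "(\<^bold>\<exists>x. P x) = (\<^bold>\<not> (\<^bold>\<forall>x. \<^bold>\<not> P x))"

text \<open>
  \<open>fm_at p [x\<^sub>0, \<dots>, x\<^sub>k]\<close> is the formula \<open>p\<close> with its free indices \<open>0, \<dots>, k\<close> replaced by
  the bound variables \<open>x\<^sub>0, \<dots>, x\<^sub>k\<close>. The remaining free indices stay free: they are the
  parameters of an axiom scheme, universally quantified through \<open>Gen\<close>.
\<close>

definition fm_at :: "fm \<Rightarrow> nat list \<Rightarrow> form" where
  "fm_at p xs = (\<lambda>d. ren (\<lambda>i. if i < length xs then d - Suc (xs ! i) else i - length xs + d) p)"


section \<open>Set-theoretic notions\<close>

definition subset :: "nat \<Rightarrow> nat \<Rightarrow> form" where
  "subset x y = (\<^bold>\<forall>u. u \<^bold>\<in> x \<^bold>\<longrightarrow> u \<^bold>\<in> y)"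

definition is_empty :: "nat \<Rightarrow> form" where
  "is_empty x = (\<^bold>\<forall>u. \<^bold>\<not> u \<^bold>\<in> x)"

text \<open>\<open>z = {x, y}\<close>\<close>
definition is_upair :: "nat \<Rightarrow> nat \<Rightarrow> nat \<Rightarrow> form" where
  "is_upair z x y = (\<^bold>\<forall>u. u \<^bold>\<in> z \<^bold>\<longleftrightarrow> u \<^bold>= x \<^bold>\<or> u \<^bold>= y)"

text \<open>\<open>z = {{x}, {x, y}}\<close>\<close>
definition is_opair :: "nat \<Rightarrow> nat \<Rightarrow> nat \<Rightarrow> form" where
  "is_opair z x y = (\<^bold>\<exists>a b. is_upair a x x \<^bold>\<and> is_upair b x y \<^bold>\<and> is_upair z a b)"

text \<open>\<open>(x, y) \<in> r\<close>; for a function \<open>r\<close> this says \<open>r(x) = y\<close>\<close>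
definition opair_in :: "nat \<Rightarrow> nat \<Rightarrow> nat \<Rightarrow> form" where
  "opair_in x y r = (\<^bold>\<exists>z. is_opair z x y \<^bold>\<and> z \<^bold>\<in> r)"

text \<open>\<open>f : A \<rightarrow> B\<close>\<close>
definition is_fun :: "nat \<Rightarrow> nat \<Rightarrow> nat \<Rightarrow> form" where
  "is_fun f A B =
    ((\<^bold>\<forall>z. z \<^bold>\<in> f \<^bold>\<longrightarrow> (\<^bold>\<exists>x y. x \<^bold>\<in> A \<^bold>\<and> y \<^bold>\<in> B \<^bold>\<and> is_opair z x y)) \<^bold>\<and>
     (\<^bold>\<forall>x. x \<^bold>\<in> A \<^bold>\<longrightarrow> (\<^bold>\<exists>y. \<^bold>\<forall>z. opair_in x z f \<^bold>\<longleftrightarrow> z \<^bold>= y)))"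

definition is_inj :: "nat \<Rightarrow> nat \<Rightarrow> nat \<Rightarrow> form" where
  "is_inj f A B =
    (is_fun f A B \<^bold>\<and> (\<^bold>\<forall>x x' y. opair_in x y f \<^bold>\<and> opair_in x' y f \<^bold>\<longrightarrow> x \<^bold>= x'))"

definition is_bij :: "nat \<Rightarrow> nat \<Rightarrow> nat \<Rightarrow> form" where
  "is_bij f A B = (is_inj f A B \<^bold>\<and> (\<^bold>\<forall>y. y \<^bold>\<in> B \<^bold>\<longrightarrow> (\<^bold>\<exists>x. opair_in x y f)))"

text \<open>\<open>y = x \<union> {x}\<close>\<close>
definition is_succ :: "nat \<Rightarrow> nat \<Rightarrow> form" where
  "is_succ y x = (\<^bold>\<forall>u. u \<^bold>\<in> y \<^bold>\<longleftrightarrow> u \<^bold>\<in> x \<^bold>\<or> u \<^bold>= x)"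

definition is_inductive :: "nat \<Rightarrow> form" where
  "is_inductive w =
    ((\<^bold>\<exists>z. is_empty z \<^bold>\<and> z \<^bold>\<in> w) \<^bold>\<and> (\<^bold>\<forall>x. x \<^bold>\<in> w \<^bold>\<longrightarrow> (\<^bold>\<exists>y. is_succ y x \<^bold>\<and> y \<^bold>\<in> w)))"

definition is_omega :: "nat \<Rightarrow> form" where
  "is_omega w = (is_inductive w \<^bold>\<and> (\<^bold>\<forall>v. is_inductive v \<^bold>\<longrightarrow> subset w v))"

definition fin :: "nat \<Rightarrow> form" where
  "fin A = (\<^bold>\<exists>w n f. is_omega w \<^bold>\<and> n \<^bold>\<in> w \<^bold>\<and> is_bij f n A)"

definition denumerable :: "nat \<Rightarrow> form" where
  "denumerable A = (\<^bold>\<exists>w f. is_omega w \<^bold>\<and> is_bij f w A)"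


section \<open>The axioms of ZF\<close>

definition extensionality :: form where
  "extensionality = (\<^bold>\<forall>x y. (\<^bold>\<forall>u. u \<^bold>\<in> x \<^bold>\<longleftrightarrow> u \<^bold>\<in> y) \<^bold>\<longrightarrow> x \<^bold>= y)"

definition foundation :: form where
  "foundation = (\<^bold>\<forall>x. (\<^bold>\<exists>u. u \<^bold>\<in> x) \<^bold>\<longrightarrow> (\<^bold>\<exists>y. y \<^bold>\<in> x \<^bold>\<and> \<^bold>\<not> (\<^bold>\<exists>u. u \<^bold>\<in> x \<^bold>\<and> u \<^bold>\<in> y)))"

definition pairing :: form where
  "pairing = (\<^bold>\<forall>x y. \<^bold>\<exists>z. is_upair z x y)"

definition union :: form where
  "union = (\<^bold>\<forall>x. \<^bold>\<exists>y. \<^bold>\<forall>u. u \<^bold>\<in> y \<^bold>\<longleftrightarrow> (\<^bold>\<exists>v. v \<^bold>\<in> x \<^bold>\<and> u \<^bold>\<in> v))"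

definition power_set :: form where
  "power_set = (\<^bold>\<forall>x. \<^bold>\<exists>y. \<^bold>\<forall>u. u \<^bold>\<in> y \<^bold>\<longleftrightarrow> subset u x)"

definition infinity :: form where
  "infinity = (\<^bold>\<exists>w. is_inductive w)"

definition separation :: "fm \<Rightarrow> form" where
  "separation p = (\<^bold>\<forall>A. \<^bold>\<exists>B. \<^bold>\<forall>x. x \<^bold>\<in> B \<^bold>\<longleftrightarrow> x \<^bold>\<in> A \<^bold>\<and> fm_at p [x])"

definition replacement :: "fm \<Rightarrow> form" where
  "replacement p =
    (\<^bold>\<forall>A. (\<^bold>\<forall>x. x \<^bold>\<in> A \<^bold>\<longrightarrow> (\<^bold>\<forall>y z. fm_at p [x, y] \<^bold>\<and> fm_at p [x, z] \<^bold>\<longrightarrow> y \<^bold>= z)) \<^bold>\<longrightarrow>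
         (\<^bold>\<exists>B. \<^bold>\<forall>y. y \<^bold>\<in> B \<^bold>\<longleftrightarrow> (\<^bold>\<exists>x. x \<^bold>\<in> A \<^bold>\<and> fm_at p [x, y])))"

definition ZF :: "fm set" where
  "ZF = {extensionality 0, foundation 0, pairing 0, union 0, power_set 0, infinity 0}
        \<union> range (\<lambda>p. separation p 0) \<union> range (\<lambda>p. replacement p 0)"


section \<open>Choice for denumerable families of finite sets\<close>

definition choice_function :: "nat \<Rightarrow> nat \<Rightarrow> form" where
  "choice_function c F =
    ((\<^bold>\<exists>U. is_fun c F U) \<^bold>\<and> (\<^bold>\<forall>x y. opair_in x y c \<^bold>\<longrightarrow> y \<^bold>\<in> x))"

definition AC_fin_omega :: form where
  "AC_fin_omega =
    (\<^bold>\<forall>F. denumerable F \<^bold>\<and> (\<^bold>\<forall>x. x \<^bold>\<in> F \<^bold>\<longrightarrow> \<^bold>\<not> is_empty x \<^bold>\<and> fin x) \<^bold>\<longrightarrow>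
         (\<^bold>\<exists>c. choice_function c F))"


section \<open>Graphs\<close>

text \<open>A graph is a set \<open>V\<close> together with a set \<open>E\<close> of two-element subsets of \<open>V\<close>.\<close>

definition graph :: "nat \<Rightarrow> nat \<Rightarrow> form" where
  "graph V E =
    (\<^bold>\<forall>e. e \<^bold>\<in> E \<^bold>\<longrightarrow> (\<^bold>\<exists>u v. u \<^bold>\<in> V \<^bold>\<and> v \<^bold>\<in> V \<^bold>\<and> \<^bold>\<not> u \<^bold>= v \<^bold>\<and> is_upair e u v))"

text \<open>\<open>{u, v} \<in> E\<close>\<close>
definition adj :: "nat \<Rightarrow> nat \<Rightarrow> nat \<Rightarrow> form" where
  "adj E u v = (\<^bold>\<exists>e. is_upair e u v \<^bold>\<and> e \<^bold>\<in> E)"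

text \<open>The degree of \<open>v\<close> is the number of edges containing \<open>v\<close>.\<close>
definition locally_finite :: "nat \<Rightarrow> nat \<Rightarrow> form" where
  "locally_finite V E =
    (\<^bold>\<forall>v. v \<^bold>\<in> V \<^bold>\<longrightarrow> (\<^bold>\<exists>D. (\<^bold>\<forall>e. e \<^bold>\<in> D \<^bold>\<longleftrightarrow> e \<^bold>\<in> E \<^bold>\<and> v \<^bold>\<in> e) \<^bold>\<and> fin D))"

text \<open>
  \<open>p\<close> is a path of length \<open>n \<in> \<omega>\<close> from \<open>u\<close> to \<open>v\<close>: a sequence \<open>p(0), \<dots>, p(n)\<close> of distinct
  vertices, indexed by the ordinal \<open>n + 1 = {0, \<dots>, n}\<close>, with consecutive ones adjacent.
\<close>
definition is_path :: "nat \<Rightarrow> nat \<Rightarrow> nat \<Rightarrow> nat \<Rightarrow> nat \<Rightarrow> nat \<Rightarrow> form" where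
  "is_path V E p n u v =
    ((\<^bold>\<exists>m. is_succ m n \<^bold>\<and> is_inj p m V) \<^bold>\<and>
     (\<^bold>\<exists>z. is_empty z \<^bold>\<and> opair_in z u p) \<^bold>\<and> opair_in n v p \<^bold>\<and>
     (\<^bold>\<forall>i. i \<^bold>\<in> n \<^bold>\<longrightarrow>
       (\<^bold>\<exists>j x y. is_succ j i \<^bold>\<and> opair_in i x p \<^bold>\<and> opair_in j y p \<^bold>\<and> adj E x y)))"

definition connected_graph :: "nat \<Rightarrow> nat \<Rightarrow> form" where
  "connected_graph V E =
    (\<^bold>\<forall>u v. u \<^bold>\<in> V \<^bold>\<and> v \<^bold>\<in> V \<^bold>\<longrightarrow> (\<^bold>\<exists>w n p. is_omega w \<^bold>\<and> n \<^bold>\<in> w \<^bold>\<and> is_path V E p n u v))"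

definition subgraph :: "nat \<Rightarrow> nat \<Rightarrow> nat \<Rightarrow> nat \<Rightarrow> form" where
  "subgraph V' E' V E = (graph V' E' \<^bold>\<and> subset V' V \<^bold>\<and> subset E' E)"

definition is_hom :: "nat \<Rightarrow> nat \<Rightarrow> nat \<Rightarrow> nat \<Rightarrow> nat \<Rightarrow> form" where
  "is_hom f V E W S =
    (is_fun f V W \<^bold>\<and>
     (\<^bold>\<forall>u v. adj E u v \<^bold>\<longrightarrow> (\<^bold>\<exists>x y. opair_in u x f \<^bold>\<and> opair_in v y f \<^bold>\<and> adj S x y)))"

end

theory Submission
  imports Defs "HOL-Library.Countable_Set" "HOL-Library.Nat_Bijection"
begin

text \<open>
  By the completeness theorem for the calculus, it suffices to argue in an arbitrary model of ZF
  with true equality. There, instances of separation and replacement are available for all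
  predicates that are definable with parameters, and the informal argument can be carried out.

  Fix a vertex. The balls \<open>b n\<close> around it are finite by local finiteness, and they exhaust the graph by
  connectedness. Call a homomorphism on a finite set of vertices good if it extends to every
  finite superset of its domain. As there are only finitely many homomorphisms on a finite set, a good
  homomorphism on \<open>b n\<close> has a good extension to \<open>b (n + 1)\<close>. So the set \<open>\<Phi> n\<close> of functions that map each
  good homomorphism on \<open>b n\<close> to a good extension on \<open>b (n + 1)\<close> is finite and nonempty. Choosing an
  element of each \<open>\<Phi> n\<close> and iterating, starting from the empty map, yields a chain of
  homomorphisms whose union is a homomorphism on the whole graph.
\<close>

text \<open>Choice in the metalogic is harmless, as it only serves to show that a derivation exists.
  Inside the model nothing may be chosen without \<open>fin_choice\<close>, and separation,
  replacement and induction carry a \<open>dfn\<close> or \<open>dft\<close> condition, discharged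
  by the syntax-directed rules \<open>dfn_intros\<close>. The natural numbers are those of the
  model, which may be nonstandard; hence the separate development of \<open>omega\<close>,
  \<open>Fin\<close> and \<open>recursion\<close>.

  The combinatorial obstacle is that picking extensions one after another is a dependent choice: the
  candidates at stage n + 1 depend on the pick at stage n. An element of \<open>\<Phi> n\<close>
  answers for every good homomorphism on the n-th ball in advance, so the whole family is given
  before any choice is made; nonemptiness needs only choice over a finite index set, which ZF
  proves. Goodness rules out dead ends, since an arbitrary homomorphism on a ball need not extend
  any further.\<close>

instance fm :: countable
  by countable_datatype

abbreviation Neg :: "fm \<Rightarrow> fm" where
  "Neg p \<equiv> Imp p Fls"

section \<open>Renaming\<close>

lemma lift_comp: "lift r (lift s i) = lift (\<lambda>i. r (s i)) i"
  by (cases i) auto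

lemma lift_id: "lift (\<lambda>i. i) = (\<lambda>i. i)"
proof
  show "lift (\<lambda>i. i) i = i" for i by (cases i) auto
qed

lemma case_nat_lift: "case_nat x s (lift r i) = case_nat x (\<lambda>i. s (r i)) i"
  by (cases i) auto

lemma ren_comp: "ren r (ren s p) = ren (\<lambda>i. r (s i)) p"
  by (induction p arbitrary: r s) (simp_all add: lift_comp)

lemma ren_id: "ren (\<lambda>i. i) p = p"
  by (induction p) (simp_all add: lift_id)

text \<open>Finiteness of the set of variables, phrased through renamings so that no notion of free
  variable is required. The bound serves to cut a renaming down to finitely many instantiations and
  to find fresh variables.\<close>

lemma ren_bounded: "\<exists>N. \<forall>r s. (\<forall>i<N. r i = s i) \<longrightarrow> ren r p = ren s p"
proof (induction p)
  case (Mem i j)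
  show ?case by (intro exI[of _ "Suc (max i j)"]) (auto simp: less_Suc_eq_le)
next
  case (Eq i j)
  show ?case by (intro exI[of _ "Suc (max i j)"]) (auto simp: less_Suc_eq_le)
next
  case (Imp p q)
  then obtain N M where "\<forall>r s. (\<forall>i<N. r i = s i) \<longrightarrow> ren r p = ren s p"
    "\<forall>r s. (\<forall>i<M. r i = s i) \<longrightarrow> ren r q = ren s q" by blast
  then show ?case by (intro exI[of _ "max N M"]) (simp add: less_max_iff_disj)
next
  case (All p)
  then obtain N where N: "\<And>r s. (\<forall>i<N. r i = s i) \<Longrightarrow> ren r p = ren s p" by blast
  have "ren (lift r) p = ren (lift s) p" if "\<forall>i<N. r i = s i" for r s
  proof (rule N, intro allI impI)
    fix i assume "i < N"
    then show "lift r i = lift s i" using that by (cases i) auto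
  qed
  then show ?case by auto
qed auto

lemma ren_inst: "ren r (inst t p) = inst (r t) (ren (lift r) p)"
proof -
  have "r (case_nat t (\<lambda>i. i) i) = case_nat (r t) (\<lambda>i. i) (lift r i)" for i by (cases i) auto
  then show ?thesis by (simp add: inst_def ren_comp)
qed

lemma inst_ren_lift: "inst x (ren (lift r) p) = ren (case_nat x r) p"
  by (simp add: inst_def ren_comp case_nat_lift)

lemma proves_inst: "T \<turnstile> p \<Longrightarrow> T \<turnstile> inst t p"
  by (rule proves.MP[OF proves.AllInst proves.Gen])

text \<open>An arbitrary renaming of the finitely many variables of \<open>p\<close> is a composition of instantiations:
  each one moves variable \<open>0\<close> out of the way of the later ones.\<close>

lemma proves_ren_prefix: "T \<turnstile> p \<Longrightarrow> T \<turnstile> ren (\<lambda>i. if i < N then r i else i - N) p"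
proof (induction N arbitrary: p r)
  case 0
  then show ?case by (simp add: ren_id)
next
  case (Suc N)
  let ?f = "\<lambda>i. if i < N then r (Suc i) else i - N"
  \<comment> \<open>The value is \<open>r 0 + N\<close> because the remaining \<open>N\<close>
    instantiations lower a large index by \<open>N\<close>, leaving \<open>r 0\<close>.\<close>
  let ?g = "case_nat (r 0 + N) (\<lambda>i. i)"
  have "T \<turnstile> ren ?f (inst (r 0 + N) p)" by (rule Suc.IH) (rule proves_inst[OF Suc.prems])
  moreover have "(\<lambda>i. ?f (?g i)) = (\<lambda>i. if i < Suc N then r i else i - Suc N)"
    by (rule ext) (simp split: nat.split)
  ultimately show ?case by (simp only: inst_def ren_comp)
qed

lemma proves_ren:
  assumes "T \<turnstile> p"
  shows "T \<turnstile> ren r p"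
proof -
  obtain N where "\<And>r s. (\<forall>i<N. r i = s i) \<Longrightarrow> ren r p = ren s p"
    using ren_bounded[of p] by blast
  then have "ren r p = ren (\<lambda>i. if i < N then r i else i - N) p" by simp
  then show ?thesis using proves_ren_prefix[OF assms, of N r] by simp
qed


section \<open>Derivations from hypotheses\<close>

text \<open>Generalization is not applied to the hypotheses in \<open>\<Gamma>\<close>.\<close>

inductive ded :: "fm set \<Rightarrow> fm set \<Rightarrow> fm \<Rightarrow> bool" for T \<Gamma> where
  Th: "T \<turnstile> p \<Longrightarrow> ded T \<Gamma> p"
| Hyp: "p \<in> \<Gamma> \<Longrightarrow> ded T \<Gamma> p"
| Mp: "ded T \<Gamma> (Imp p q) \<Longrightarrow> ded T \<Gamma> p \<Longrightarrow> ded T \<Gamma> q"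

lemma ded_empty: "ded T {} p \<Longrightarrow> T \<turnstile> p"
  by (induction rule: ded.induct) (simp_all, erule (1) proves.MP)

lemma ded_mono: "ded T \<Gamma> p \<Longrightarrow> \<Gamma> \<subseteq> \<Delta> \<Longrightarrow> ded T \<Delta> p"
  by (induction rule: ded.induct) (blast intro: ded.Th, blast intro: ded.Hyp, rule ded.Mp)

lemma ded_finite: "ded T \<Gamma> p \<Longrightarrow> \<exists>\<Delta>\<subseteq>\<Gamma>. finite \<Delta> \<and> ded T \<Delta> p"
proof (induction rule: ded.induct)
  case (Th p)
  then show ?case by (intro exI[of _ "{}"]) (simp add: ded.Th)
next
  case (Hyp p)
  then show ?case by (intro exI[of _ "{p}"]) (simp add: ded.Hyp)
next
  case (Mp p q)
  then obtain \<Delta> \<Delta>' where "\<Delta> \<subseteq> \<Gamma>" "finite \<Delta>" "ded T \<Delta> (Imp p q)" "\<Delta>' \<subseteq> \<Gamma>" "finite \<Delta>'" "ded T \<Delta>' p"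
    by auto
  then show ?case
    by (intro exI[of _ "\<Delta> \<union> \<Delta>'"] conjI ded.Mp[of T _ p q]) (auto elim: ded_mono)
qed

lemma ded_contradiction: "p \<in> \<Gamma> \<Longrightarrow> Neg p \<in> \<Gamma> \<Longrightarrow> ded T \<Gamma> Fls"
  by (rule ded.Mp[OF ded.Hyp ded.Hyp])

lemma ded_K: "ded T \<Gamma> q \<Longrightarrow> ded T \<Gamma> (Imp p q)"
  by (rule ded.Mp[OF ded.Th[OF proves.K]])

lemma ded_S: "ded T \<Gamma> (Imp p (Imp q r)) \<Longrightarrow> ded T \<Gamma> (Imp p q) \<Longrightarrow> ded T \<Gamma> (Imp p r)"
  by (rule ded.Mp[OF ded.Mp[OF ded.Th[OF proves.S]]])

lemma ded_refl: "ded T \<Gamma> (Imp p p)"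
  by (rule ded_S[of _ _ _ "Imp p p"]) (rule ded.Th, rule proves.K)+

lemma deduction: "ded T (insert p \<Gamma>) q \<Longrightarrow> ded T \<Gamma> (Imp p q)"
proof (induction rule: ded.induct)
  case (Th q)
  then show ?case by (rule ded_K[OF ded.Th])
next
  case (Hyp q)
  then show ?case by (auto intro: ded_refl ded_K[OF ded.Hyp])
next
  case (Mp q r)
  show ?case by (rule ded_S[OF Mp.IH])
qed

lemma ded_DN: "ded T (insert (Neg p) \<Gamma>) Fls \<Longrightarrow> ded T \<Gamma> p"
  by (rule ded.Mp[OF ded.Th[OF proves.DN] deduction])

lemma ded_Fls: "ded T \<Gamma> Fls \<Longrightarrow> ded T \<Gamma> p"
  by (rule ded_DN) (erule ded_mono, blast)

lemma ded_ren: "ded T \<Gamma> p \<Longrightarrow> ded T (ren r ` \<Gamma>) (ren r p)"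
proof (induction rule: ded.induct)
  case (Mp p q)
  show ?case by (rule ded.Mp[OF Mp.IH(1)[simplified] Mp.IH(2)])
qed (auto intro: ded.Th ded.Hyp proves_ren)

text \<open>Shifting \<Gamma> by \<open>Suc\<close> keeps variable 0 out of the hypotheses, which is
  the eigenvariable condition in de Bruijn form. Hypotheses generalize by \<open>AllVac\<close>, and
  \<open>AllDistr\<close> carries the quantifier through modus ponens.\<close>

lemma ded_gen: "ded T (ren Suc ` \<Gamma>) p \<Longrightarrow> ded T \<Gamma> (All p)"
proof (induction rule: ded.induct)
  case (Th p)
  then show ?case by (rule ded.Th[OF proves.Gen])
next
  case (Hyp p)
  then show ?case by (auto intro: ded.Mp[OF ded.Th[OF proves.AllVac]] ded.Hyp)
next
  case (Mp p q)
  show ?case by (rule ded.Mp[OF ded.Mp[OF ded.Th[OF proves.AllDistr] Mp.IH(1)] Mp.IH(2)])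
qed

text \<open>Freshness as indifference of renaming to the value at \<open>x\<close>; in this form it
  allows one renaming to be replaced by another in \<open>ded_gen_fresh\<close>.\<close>

definition fresh :: "nat \<Rightarrow> fm \<Rightarrow> bool" where
  "fresh x p \<longleftrightarrow> (\<forall>r s. (\<forall>i. i \<noteq> x \<longrightarrow> r i = s i) \<longrightarrow> ren r p = ren s p)"

lemma ex_fresh:
  assumes "finite \<Gamma>"
  shows "\<exists>x. \<forall>p\<in>\<Gamma>. fresh x p"
proof -
  have "\<exists>N. \<forall>x\<ge>N. fresh x p" for p
  proof -
    obtain N where N: "\<And>r s. (\<forall>i<N. r i = s i) \<Longrightarrow> ren r p = ren s p"
      using ren_bounded[of p] by blast
    have "fresh x p" if "N \<le> x" for x
      unfolding fresh_def
    proof (intro allI impI)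
      fix r s :: "nat \<Rightarrow> nat"
      assume "\<forall>i. i \<noteq> x \<longrightarrow> r i = s i"
      then show "ren r p = ren s p" using that by (intro N) auto
    qed
    then show ?thesis by blast
  qed
  then obtain N where "\<And>p x. x \<ge> N p \<Longrightarrow> fresh x p" by metis
  moreover have "\<forall>p\<in>\<Gamma>. N p \<le> Max (N ` \<Gamma>)" using assms by simp
  ultimately show ?thesis by blast
qed

lemma ded_gen_fresh:
  assumes "ded T \<Gamma> (inst x p)" "\<forall>q\<in>\<Gamma>. fresh x q" "fresh x (All p)"
  shows "ded T \<Gamma> (All p)"
proof (rule ded_gen)
  \<comment> \<open>Away from \<open>x\<close> this is \<open>Suc\<close>, so it acts as the shift
    on formulas in which \<open>x\<close> is fresh; and it sends \<open>x\<close> to 0, which undoes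
    the instantiation at \<open>x\<close>.\<close>
  define r where "r i = (if i = x then 0 else Suc i)" for i
  have "ren r q = ren Suc q" if "fresh x q" for q
    using that unfolding fresh_def by (elim allE impE) (auto simp: r_def)
  then have "ren r ` \<Gamma> = ren Suc ` \<Gamma>" using assms(2) by (intro image_cong) auto
  moreover have "ren r (inst x p) = p"
  proof -
    have "ren r (All p) = ren Suc (All p)"
      using assms(3) unfolding fresh_def by (elim allE impE) (auto simp: r_def)
    then have "ren (lift r) p = ren (lift Suc) p" by simp
    moreover have "(\<lambda>i. case_nat 0 (\<lambda>i. i) (lift Suc i)) = (\<lambda>i. i)"
      by (rule ext) (simp add: case_nat_lift split: nat.split)
    ultimately show ?thesis
      by (simp add: ren_inst r_def) (simp add: inst_def ren_comp ren_id)
  qed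
  ultimately show "ded T (ren Suc ` \<Gamma>) p" using ded_ren[OF assms(1), of r] by simp
qed


section \<open>Completeness\<close>

text \<open>Equality has its own interpretation \<open>Q\<close>: in the term model it is the
  relation \<open>Eq i j \<in> \<Gamma>\<close> between variables, which becomes identity only after
  a quotient.\<close>

primrec sat :: "('a \<Rightarrow> 'a \<Rightarrow> bool) \<Rightarrow> ('a \<Rightarrow> 'a \<Rightarrow> bool) \<Rightarrow> (nat \<Rightarrow> 'a) \<Rightarrow> fm \<Rightarrow> bool" where
  "sat R Q e (Mem i j) = R (e i) (e j)"
| "sat R Q e (Eq i j) = Q (e i) (e j)"
| "sat R Q e Fls = False"
| "sat R Q e (Imp p q) = (sat R Q e p \<longrightarrow> sat R Q e q)"
| "sat R Q e (All p) = (\<forall>x. sat R Q (case_nat x e) p)"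

lemma sat_ren: "sat R Q e (ren r p) = sat R Q (\<lambda>i. e (r i)) p"
proof (induction p arbitrary: e r)
  case (All p)
  have "(\<lambda>i. case_nat x e (lift r i)) = case_nat x (\<lambda>i. e (r i))" for x
    by (rule ext) (rule case_nat_lift)
  then show ?case by (simp add: All)
qed auto

text \<open>Witnesses are variables instead of new constants. The language has no constants, and the
  stages of the construction are finite, so fresh variables never run out.\<close>

definition henkin :: "fm set \<Rightarrow> fm set \<Rightarrow> bool" where
  "henkin T \<Gamma> \<longleftrightarrow> \<not> ded T \<Gamma> Fls \<and> (\<forall>p. p \<in> \<Gamma> \<or> Neg p \<in> \<Gamma>) \<and>
     (\<forall>p. Neg (All p) \<in> \<Gamma> \<longrightarrow> (\<exists>x. Neg (inst x p) \<in> \<Gamma>))"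

lemma consistent_cases:
  "\<not> ded T \<Gamma> Fls \<Longrightarrow> \<not> ded T (insert p \<Gamma>) Fls \<or> \<not> ded T (insert (Neg p) \<Gamma>) Fls"
  using ded.Mp[OF deduction ded_DN, of T p \<Gamma> Fls] by blast

text \<open>For a fresh \<open>x\<close>, a refutation of the witness would derive
  \<open>inst x p\<close>, hence \<open>All p\<close> by generalization, which contradicts
  \<open>Neg (All p)\<close>.\<close>

lemma consistent_witness:
  assumes "\<not> ded T \<Gamma> Fls" "Neg (All p) \<in> \<Gamma>" "finite \<Gamma>"
  shows "\<exists>x. \<not> ded T (insert (Neg (inst x p)) \<Gamma>) Fls"
proof -
  obtain x where x: "\<forall>q\<in>insert (All p) \<Gamma>. fresh x q" using ex_fresh assms(3) by blast
  have "\<not> ded T (insert (Neg (inst x p)) \<Gamma>) Fls"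
  proof
    assume "ded T (insert (Neg (inst x p)) \<Gamma>) Fls"
    then have "ded T \<Gamma> (All p)" using x by (intro ded_gen_fresh[of _ _ x]) (auto intro: ded_DN)
    then show False using assms(1) ded.Mp[OF ded.Hyp[OF assms(2)]] by blast
  qed
  then show ?thesis by blast
qed

text \<open>An accepted negated universal receives its witness at once. If \<open>p\<close> is
  rejected, the last conjunct is vacuous, because the consistent set
  \<open>insert (Neg p) \<Gamma>\<close> cannot contain \<open>p\<close>.\<close>

lemma henkin_extension_step:
  assumes "finite \<Gamma>" "\<not> ded T \<Gamma> Fls"
  shows "\<exists>\<Delta>. (finite \<Delta> \<and> \<not> ded T \<Delta> Fls) \<and> \<Gamma> \<subseteq> \<Delta> \<and> (p \<in> \<Delta> \<or> Neg p \<in> \<Delta>) \<and>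
           (\<forall>q. p = Neg (All q) \<and> p \<in> \<Delta> \<longrightarrow> (\<exists>x. Neg (inst x q) \<in> \<Delta>))"
proof (cases "ded T (insert p \<Gamma>) Fls")
  case True
  then have cons: "\<not> ded T (insert (Neg p) \<Gamma>) Fls" using consistent_cases assms(2) by blast
  moreover have "p \<notin> insert (Neg p) \<Gamma>"
    using cons ded_contradiction[of p "insert (Neg p) \<Gamma>" T] by blast
  ultimately show ?thesis using assms(1) by (intro exI[of _ "insert (Neg p) \<Gamma>"]) auto
next
  case False
  show ?thesis
  proof (cases "\<exists>q. p = Neg (All q)")
    case True
    then obtain q where q: "p = Neg (All q)" by blast
    then obtain x where "\<not> ded T (insert (Neg (inst x q)) (insert p \<Gamma>)) Fls"
      using consistent_witness[OF False, of q] assms(1) by auto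
    then show ?thesis using q assms(1)
      by (intro exI[of _ "insert (Neg (inst x q)) (insert p \<Gamma>)"]) auto
  next
    case no: False
    show ?thesis
      by (intro exI[of _ "insert p \<Gamma>"]) (use False no assms(1) in auto)
  qed
qed

lemma ex_henkin:
  assumes "\<not> ded T {p} Fls"
  shows "\<exists>\<Gamma>. p \<in> \<Gamma> \<and> henkin T \<Gamma>"
proof -
  define P where "P \<Delta> \<longleftrightarrow> finite \<Delta> \<and> \<not> ded T \<Delta> Fls" for \<Delta>
  define step where "step n \<Gamma> \<Delta> \<longleftrightarrow> (\<Gamma> \<subseteq> \<Delta> \<and> (from_nat n \<in> \<Delta> \<or> Neg (from_nat n) \<in> \<Delta>) \<and>
    (\<forall>q. from_nat n = Neg (All q) \<and> from_nat n \<in> \<Delta> \<longrightarrow> (\<exists>x. Neg (inst x q) \<in> \<Delta>)))"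
    for n :: nat and \<Gamma> \<Delta>
  \<comment> \<open>Stage \<open>n\<close> treats the formula with code \<open>n\<close>; since
    \<open>fm\<close> is countable, every formula has a stage.\<close>
  have "\<exists>f. \<forall>n. (P (f n) \<and> (n = 0 \<longrightarrow> f n = {p})) \<and> step n (f n) (f (Suc n))"
  proof (rule dependent_nat_choice)
    show "\<exists>\<Delta>. P \<Delta> \<and> ((0::nat) = 0 \<longrightarrow> \<Delta> = {p})" using assms by (auto simp: P_def)
    show "\<exists>\<Delta>. (P \<Delta> \<and> (Suc n = 0 \<longrightarrow> \<Delta> = {p})) \<and> step n \<Gamma> \<Delta>"
      if "P \<Gamma> \<and> (n = 0 \<longrightarrow> \<Gamma> = {p})" for \<Gamma> n
    proof -
      have "finite \<Gamma>" "\<not> ded T \<Gamma> Fls" using that by (simp_all add: P_def)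
      from henkin_extension_step[OF this, of "from_nat n"] show ?thesis
        unfolding P_def step_def by simp
    qed
  qed
  then obtain f where f: "\<And>n. P (f n)" "f 0 = {p}" "\<And>n. step n (f n) (f (Suc n))" by auto
  define \<Gamma> where "\<Gamma> = (\<Union>n. f n)"
  have mono: "m \<le> n \<Longrightarrow> f m \<subseteq> f n" for m n
    using lift_Suc_mono_le[of f] f(3) unfolding step_def by blast
  have cons: "\<not> ded T \<Gamma> Fls"
  proof
    assume "ded T \<Gamma> Fls"
    from ded_finite[OF this] obtain \<Delta> where "\<Delta> \<subseteq> \<Gamma>" and fin_\<Delta>: "finite \<Delta>" and \<Delta>: "ded T \<Delta> Fls" by blast
    then have "\<forall>q\<in>\<Delta>. \<exists>n. q \<in> f n" by (auto simp: \<Gamma>_def)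
    then obtain n where n: "\<forall>q\<in>\<Delta>. q \<in> f (n q)" by (elim bchoice[THEN exE])
    have "q \<in> f (Max (n ` \<Delta>))" if "q \<in> \<Delta>" for q
      using mono[of "n q" "Max (n ` \<Delta>)"] n that fin_\<Delta> by (meson Max_ge finite_imageI image_eqI subsetD)
    then have "ded T (f (Max (n ` \<Delta>))) Fls" by (intro ded_mono[OF \<Delta>] subsetI)
    then show False using f(1)[of "Max (n ` \<Delta>)"] by (simp add: P_def)
  qed
  have total: "q \<in> \<Gamma> \<or> Neg q \<in> \<Gamma>" for q
    using f(3)[of "to_nat q"] unfolding step_def \<Gamma>_def by (simp only: from_nat_to_nat) blast
  have witness: "\<exists>x. Neg (inst x q) \<in> \<Gamma>" if "Neg (All q) \<in> \<Gamma>" for q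
  proof -
    let ?n = "to_nat (Neg (All q))"
    \<comment> \<open>A formula in the limit was accepted at its own stage: otherwise its negation
      was, and the limit would be inconsistent. So the witness was added at that stage.\<close>
    have "Neg (All q) \<in> f (Suc ?n)"
    proof (rule ccontr)
      assume "Neg (All q) \<notin> f (Suc ?n)"
      then have "Neg (Neg (All q)) \<in> \<Gamma>"
        using f(3)[of ?n] unfolding step_def \<Gamma>_def by (simp only: from_nat_to_nat) blast
      then show False using cons ded_contradiction[OF that] by blast
    qed
    then show ?thesis using f(3)[of ?n] unfolding step_def \<Gamma>_def by (simp only: from_nat_to_nat) blast
  qed
  have "p \<in> \<Gamma>" using f(2) by (auto simp: \<Gamma>_def)
  then show ?thesis using cons total witness by (auto simp: henkin_def)
qed

lemma henkinD:
  assumes "henkin T \<Gamma>"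
  shows "\<not> ded T \<Gamma> Fls" "p \<notin> \<Gamma> \<Longrightarrow> Neg p \<in> \<Gamma>" "Neg (All p) \<in> \<Gamma> \<Longrightarrow> \<exists>x. Neg (inst x p) \<in> \<Gamma>"
  using assms by (auto simp: henkin_def)

lemma henkin_ded:
  assumes "henkin T \<Gamma>"
  shows "ded T \<Gamma> p \<longleftrightarrow> p \<in> \<Gamma>"
proof
  assume d: "ded T \<Gamma> p"
  have "Neg p \<notin> \<Gamma>"
  proof
    assume "Neg p \<in> \<Gamma>"
    from ded.Mp[OF ded.Hyp[OF this] d] show False using henkinD(1)[OF assms] by blast
  qed
  then show "p \<in> \<Gamma>" using henkinD(2)[OF assms] by blast
qed (rule ded.Hyp)

text \<open>Truth lemma for the term model, whose elements are the variables themselves.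
  Environments are therefore renamings, and the quantifier case reduces to instances by
  \<open>inst_ren_lift\<close>.\<close>

lemma henkin_sat:
  assumes "henkin T \<Gamma>"
  shows "sat (\<lambda>i j. Mem i j \<in> \<Gamma>) (\<lambda>i j. Eq i j \<in> \<Gamma>) r p \<longleftrightarrow> ren r p \<in> \<Gamma>"
proof (induction p arbitrary: r)
  case Fls
  then show ?case using henkinD(1)[OF assms] ded.Hyp[of Fls \<Gamma> T] by auto
next
  case (Imp p q)
  have "Imp p' q' \<in> \<Gamma> \<longleftrightarrow> (p' \<in> \<Gamma> \<longrightarrow> q' \<in> \<Gamma>)" for p' q'
  proof
    assume pq: "Imp p' q' \<in> \<Gamma>"
    show "p' \<in> \<Gamma> \<longrightarrow> q' \<in> \<Gamma>"
    proof
      assume "p' \<in> \<Gamma>"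
      then show "q' \<in> \<Gamma>"
        by (rule iffD1[OF henkin_ded[OF assms] ded.Mp[OF ded.Hyp[OF pq] ded.Hyp]])
    qed
  next
    assume *: "p' \<in> \<Gamma> \<longrightarrow> q' \<in> \<Gamma>"
    have "ded T \<Gamma> (Imp p' q')"
    proof (cases "p' \<in> \<Gamma>")
      case True
      then show ?thesis using * by (intro ded_K[OF ded.Hyp]) blast
    next
      case False
      then have "Neg p' \<in> \<Gamma>" by (rule henkinD(2)[OF assms])
      then show ?thesis by (intro deduction[OF ded_Fls[OF ded_contradiction[of p']]]) auto
    qed
    then show "Imp p' q' \<in> \<Gamma>" by (simp only: henkin_ded[OF assms])
  qed
  then show ?case using Imp by simp
next
  case (All p)
  have "(\<forall>x. inst x q \<in> \<Gamma>) \<longleftrightarrow> All q \<in> \<Gamma>" for q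
  proof
    assume *: "\<forall>x. inst x q \<in> \<Gamma>"
    show "All q \<in> \<Gamma>"
    proof (rule ccontr)
      assume "All q \<notin> \<Gamma>"
      then obtain x where "Neg (inst x q) \<in> \<Gamma>" using henkinD(2,3)[OF assms] by blast
      from ded_contradiction[OF *[rule_format] this] show False using henkinD(1)[OF assms] by blast
    qed
  next
    assume "All q \<in> \<Gamma>"
    then have "ded T \<Gamma> (inst x q)" for x
      by (rule ded.Mp[OF ded.Th[OF proves.AllInst] ded.Hyp])
    then show "\<forall>x. inst x q \<in> \<Gamma>" by (simp add: henkin_ded[OF assms])
  qed
  then show ?case by (simp add: All flip: inst_ren_lift)
qed auto

section \<open>Passage to models in which equality is identity\<close>

definition congruence :: "('a \<Rightarrow> 'a \<Rightarrow> bool) \<Rightarrow> ('a \<Rightarrow> 'a \<Rightarrow> bool) \<Rightarrow> bool" where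
  "congruence R Q \<longleftrightarrow> equivp Q \<and> (\<forall>x x' y y'. Q x x' \<and> Q y y' \<and> R x y \<longrightarrow> R x' y')"

lemma henkin_congruence:
  assumes "henkin T \<Gamma>"
  shows "congruence (\<lambda>i j. Mem i j \<in> \<Gamma>) (\<lambda>i j. Eq i j \<in> \<Gamma>)"
proof -
  have subst: "inst i p \<in> \<Gamma> \<Longrightarrow> inst j p \<in> \<Gamma>" if "Eq i j \<in> \<Gamma>" for i j p
  proof -
    assume "inst i p \<in> \<Gamma>"
    then show "inst j p \<in> \<Gamma>"
      by (rule iffD1[OF henkin_ded[OF assms]
        ded.Mp[OF ded.Mp[OF ded.Th[OF proves.EqSubst] ded.Hyp[OF that]] ded.Hyp]])
  qed
  have refl: "Eq i i \<in> \<Gamma>" for i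
    using ded.Th[OF proves.EqRefl] by (simp only: henkin_ded[OF assms, symmetric])
  \<comment> \<open>Variable 0 marks the place of substitution, and \<open>Suc k\<close> becomes
    \<open>k\<close> under \<open>inst\<close>. Taking \<open>k = i\<close> and reflexivity yields
    symmetry below.\<close>
  have eq_left: "Eq i k \<in> \<Gamma> \<Longrightarrow> Eq j k \<in> \<Gamma>" if "Eq i j \<in> \<Gamma>" for i j k
    using subst[OF that, of "Eq 0 (Suc k)"] by (simp add: inst_def)
  have mem_left: "Mem i k \<in> \<Gamma> \<Longrightarrow> Mem j k \<in> \<Gamma>" if "Eq i j \<in> \<Gamma>" for i j k
    using subst[OF that, of "Mem 0 (Suc k)"] by (simp add: inst_def)
  have mem_right: "Mem k i \<in> \<Gamma> \<Longrightarrow> Mem k j \<in> \<Gamma>" if "Eq i j \<in> \<Gamma>" for i j k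
    using subst[OF that, of "Mem (Suc k) 0"] by (simp add: inst_def)
  have eq_sym: "Eq j i \<in> \<Gamma>" if "Eq i j \<in> \<Gamma>" for i j by (rule eq_left[OF that refl])
  have "equivp (\<lambda>i j. Eq i j \<in> \<Gamma>)"
    by (intro equivpI reflpI sympI transpI refl) (erule eq_sym, erule eq_left[OF eq_sym])
  moreover have "Mem x' y' \<in> \<Gamma>" if "Eq x x' \<in> \<Gamma>" "Eq y y' \<in> \<Gamma>" "Mem x y \<in> \<Gamma>" for x x' y y'
    by (rule mem_left[OF that(1) mem_right[OF that(2,3)]])
  ultimately show ?thesis unfolding congruence_def by (intro conjI allI impI) (simp, elim conjE)
qed

theorem prestructure_completeness:
  assumes "\<And>(R :: nat \<Rightarrow> nat \<Rightarrow> bool) Q e. congruence R Q \<Longrightarrow> (\<And>q e. q \<in> T \<Longrightarrow> sat R Q e q) \<Longrightarrow> sat R Q e p"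
  shows "T \<turnstile> p"
proof (rule ccontr)
  assume "\<not> (T \<turnstile> p)"
  then have "\<not> ded T {Neg p} Fls" using ded_empty[OF ded_DN] by blast
  then obtain \<Gamma> where \<Gamma>: "Neg p \<in> \<Gamma>" "henkin T \<Gamma>" using ex_henkin by blast
  have "sat (\<lambda>i j. Mem i j \<in> \<Gamma>) (\<lambda>i j. Eq i j \<in> \<Gamma>) (\<lambda>i. i) p"
  proof (rule assms)
    show "congruence (\<lambda>i j. Mem i j \<in> \<Gamma>) (\<lambda>i j. Eq i j \<in> \<Gamma>)" by (rule henkin_congruence[OF \<Gamma>(2)])
    show "sat (\<lambda>i j. Mem i j \<in> \<Gamma>) (\<lambda>i j. Eq i j \<in> \<Gamma>) e q" if "q \<in> T" for q e
      using ded.Th[OF proves_ren[OF proves.Ax[OF that]]]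
      unfolding henkin_sat[OF \<Gamma>(2)] by (rule iffD1[OF henkin_ded[OF \<Gamma>(2)]])
  qed
  then have "p \<in> \<Gamma>" using henkin_sat[OF \<Gamma>(2)] by (simp add: ren_id)
  from ded_contradiction[OF this \<Gamma>(1)] show False using henkinD(1)[OF \<Gamma>(2)] by blast
qed

lemma sat_quotient:
  assumes "surj h" "\<And>x y. Q x y \<longleftrightarrow> h x = h y" "\<And>x y. R x y \<longleftrightarrow> R' (h x) (h y)"
  shows "sat R' (=) (\<lambda>i. h (e i)) p \<longleftrightarrow> sat R Q e p"
proof (induction p arbitrary: e)
  case (All p)
  have "(\<lambda>i. h (case_nat x e i)) = case_nat (h x) (\<lambda>i. h (e i))" for x
    by (rule ext) (simp split: nat.split)
  then have "sat R' (=) (case_nat (h x) (\<lambda>i. h (e i))) p \<longleftrightarrow> sat R Q (case_nat x e) p" for x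
    using All[of "case_nat x e"] by simp
  then show ?case using assms(1) by (metis sat.simps(5) surjD)
qed (simp_all add: assms)

text \<open>A premise can range over models on one fixed type only. A prestructure on
  \<open>nat\<close> has countably many classes modulo \<open>Q\<close>, and \<open>inf\<close>
  makes them infinitely many, so they can be numbered and the quotient lives on \<open>nat\<close>
  again.\<close>

theorem completeness:
  assumes inf: "\<And>(R :: nat \<Rightarrow> nat \<Rightarrow> bool) Q D. congruence R Q \<Longrightarrow> (\<And>q e. q \<in> T \<Longrightarrow> sat R Q e q) \<Longrightarrow>
      finite D \<Longrightarrow> \<exists>x. \<forall>y\<in>D. \<not> Q x y"
    and mod: "\<And>(R :: nat \<Rightarrow> nat \<Rightarrow> bool) e. (\<And>q e. q \<in> T \<Longrightarrow> sat R (=) e q) \<Longrightarrow> sat R (=) e p"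
  shows "T \<turnstile> p"
proof (rule prestructure_completeness)
  fix R Q :: "nat \<Rightarrow> nat \<Rightarrow> bool" and e
  assume cong: "congruence R Q" and T: "\<And>q e. q \<in> T \<Longrightarrow> sat R Q e q"
  define \<rho> where "\<rho> x = (LEAST y. Q x y)" for x
  have eq: "equivp Q" using cong by (simp add: congruence_def)
  have Q_\<rho>: "Q x (\<rho> x)" for x unfolding \<rho>_def by (rule LeastI) (rule equivp_reflp[OF eq])
  have \<rho>_iff: "Q x y \<longleftrightarrow> \<rho> x = \<rho> y" for x y
  proof
    show "Q x y \<Longrightarrow> \<rho> x = \<rho> y" using eq by (simp add: equivp_def \<rho>_def)
    show "\<rho> x = \<rho> y \<Longrightarrow> Q x y" using Q_\<rho> eq equivp_symp equivp_transp by metis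
  qed
  have "infinite (range \<rho>)"
  proof
    assume "finite (range \<rho>)"
    from inf[OF cong T this] obtain x where "\<forall>y\<in>range \<rho>. \<not> Q x y" by blast
    then show False using Q_\<rho> by blast
  qed
  then have bij: "bij_betw (to_nat_on (range \<rho>)) (range \<rho>) UNIV"
    using to_nat_on_infinite countableI_type by blast
  define h where "h x = to_nat_on (range \<rho>) (\<rho> x)" for x
  have surj: "surj h"
    using bij_betw_imp_surj_on[OF bij] by (simp add: h_def image_image)
  have h_iff: "Q x y \<longleftrightarrow> h x = h y" for x y
    using \<rho>_iff bij_betw_imp_inj_on[OF bij] by (simp add: h_def inj_on_eq_iff)
  define R' where "R' x y \<longleftrightarrow> R (inv h x) (inv h y)" for x y
  have "Q x (inv h (h x))" for x using h_iff surj by (simp add: surj_f_inv_f)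
  then have R: "R x y \<longleftrightarrow> R' (h x) (h y)" for x y
    using cong equivp_symp[OF eq] unfolding R'_def congruence_def by blast
  have sat: "sat R' (=) (\<lambda>i. h (e i)) q \<longleftrightarrow> sat R Q e q" for e q
    by (rule sat_quotient[where h = h]) (fact surj h_iff R)+
  have "sat R' (=) e q" if "q \<in> T" for q e
    using sat[of "\<lambda>i. inv h (e i)" q] T that surj by (simp add: surj_f_inv_f)
  then have "sat R' (=) (\<lambda>i. h (e i)) p" by (rule mod)
  then show "sat R Q e p" by (simp add: sat)
qed

section \<open>Evaluation of formulas with named variables\<close>

text \<open>The value of level \<open>x\<close> under \<open>d\<close> quantifiers.\<close>

definition val :: "(nat \<Rightarrow> 'a) \<Rightarrow> nat \<Rightarrow> nat \<Rightarrow> 'a" where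
  "val e d x = e (d - Suc x)"

text \<open>Entering a quantifier changes de Bruijn indices but no levels. With this equation and
  the next one, named formulas can be evaluated by simplification, the bounds \<open>x < d\<close>
  being settled by arithmetic.\<close>

lemma val_outer [simp]: "x < d \<Longrightarrow> val (case_nat a e) (Suc d) x = val e d x"
  by (auto simp: val_def split: nat.split intro!: arg_cong[of _ _ e])

lemma val_innermost [simp]: "val (case_nat a e) (Suc d) d = a"
  by (simp add: val_def)

lemma sat_connectives [simp]:
  "sat R Q e ((x \<^bold>\<in> y) d) \<longleftrightarrow> R (val e d x) (val e d y)"
  "sat R Q e ((x \<^bold>= y) d) \<longleftrightarrow> Q (val e d x) (val e d y)"
  "sat R Q e ((\<phi> \<^bold>\<longrightarrow> \<psi>) d) \<longleftrightarrow> (sat R Q e (\<phi> d) \<longrightarrow> sat R Q e (\<psi> d))"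
  "sat R Q e ((\<^bold>\<not> \<phi>) d) \<longleftrightarrow> \<not> sat R Q e (\<phi> d)"
  "sat R Q e ((\<phi> \<^bold>\<and> \<psi>) d) \<longleftrightarrow> sat R Q e (\<phi> d) \<and> sat R Q e (\<psi> d)"
  "sat R Q e ((\<phi> \<^bold>\<or> \<psi>) d) \<longleftrightarrow> sat R Q e (\<phi> d) \<or> sat R Q e (\<psi> d)"
  "sat R Q e ((\<phi> \<^bold>\<longleftrightarrow> \<psi>) d) \<longleftrightarrow> (sat R Q e (\<phi> d) \<longleftrightarrow> sat R Q e (\<psi> d))"
  "sat R Q e (all \<Phi> d) \<longleftrightarrow> (\<forall>a. sat R Q (case_nat a e) (\<Phi> d (Suc d)))"
  "sat R Q e (ex \<Phi> d) \<longleftrightarrow> (\<exists>a. sat R Q (case_nat a e) (\<Phi> d (Suc d)))"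
  by (auto simp: mem_def eql_def imp_def neg_def conj_def disj_def iff_def all_def ex_def val_def)

lemma sat_is_upair [simp]:
  "z < d \<Longrightarrow> x < d \<Longrightarrow> y < d \<Longrightarrow> sat R Q e (is_upair z x y d) \<longleftrightarrow>
    (\<forall>u. R u (val e d z) \<longleftrightarrow> Q u (val e d x) \<or> Q u (val e d y))"
  by (simp add: is_upair_def less_Suc_eq)

text \<open>From finitely many classes, pairing and union would build a set containing everything,
  itself included; foundation for its singleton excludes that. The fact is needed before the
  quotient is formed, hence \<open>Q\<close> in place of identity.\<close>

lemma ZF_prestructure_infinite:
  assumes cong: "congruence R Q" and ZF: "\<And>q e. q \<in> ZF \<Longrightarrow> sat R Q e q" and "finite D"
  shows "\<exists>x. \<forall>y\<in>D. \<not> Q x y"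
proof (rule ccontr)
  assume *: "\<not> (\<exists>x. \<forall>y\<in>D. \<not> Q x y)"
  have eq: "equivp Q" using cong by (simp add: congruence_def)
  have R_cong: "Q x x' \<Longrightarrow> Q y y' \<Longrightarrow> R x y \<Longrightarrow> R x' y'" for x x' y y'
    using cong unfolding congruence_def by blast
  have "sat R Q undefined (pairing 0)" "sat R Q undefined (union 0)" "sat R Q undefined (foundation 0)"
    by (rule ZF; simp add: ZF_def)+
  then have pair: "\<forall>x y. \<exists>z. \<forall>u. R u z \<longleftrightarrow> Q u x \<or> Q u y"
    and union: "\<forall>x. \<exists>y. \<forall>u. R u y \<longleftrightarrow> (\<exists>v. R v x \<and> R u v)"
    and found: "\<forall>x. (\<exists>u. R u x) \<longrightarrow> (\<exists>y. R y x \<and> \<not> (\<exists>u. R u x \<and> R u y))"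
    by (simp_all add: pairing_def union_def foundation_def)
  have "\<exists>z. \<forall>a\<in>D. R a z"
    using \<open>finite D\<close>
  proof induction
    case (insert a D)
    then obtain z where z: "\<forall>a\<in>D. R a z" by blast
    obtain s where s: "\<forall>u. R u s \<longleftrightarrow> Q u a \<or> Q u a" using pair by blast
    obtain t where t: "\<forall>u. R u t \<longleftrightarrow> Q u z \<or> Q u s" using pair by blast
    obtain y where y: "\<forall>u. R u y \<longleftrightarrow> (\<exists>v. R v t \<and> R u v)" using union by blast
    have "\<forall>b\<in>insert a D. R b y" using z s t y equivp_reflp[OF eq] by blast
    then show ?case by blast
  qed simp
  then obtain z where z: "\<forall>a\<in>D. R a z" by blast
  have "R x z" for x
  proof -
    obtain y where "y \<in> D" "Q x y" using * by blast
    then show ?thesis using z R_cong[of y x z z] equivp_symp[OF eq] equivp_reflp[OF eq] by blast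
  qed
  moreover obtain s where s: "\<forall>u. R u s \<longleftrightarrow> Q u z \<or> Q u z" using pair by blast
  moreover obtain y where "R y s" "\<not> (\<exists>u. R u s \<and> R u y)"
    using found s equivp_reflp[OF eq] by blast
  ultimately show False using R_cong[of z z z y] equivp_reflp[OF eq] equivp_symp[OF eq] by blast
qed


section \<open>Definability in a model of ZF\<close>

text \<open>Environments are split into variables \<open>e\<close> and parameters \<open>c\<close>.\<close>

definition mix :: "(nat \<Rightarrow> 'a) \<Rightarrow> (nat \<Rightarrow> 'a) \<Rightarrow> nat \<Rightarrow> 'a" where
  "mix e c i = case_sum e c (sum_decode i)"

lemma mix_encode [simp]:
  "mix e c (sum_encode (Inl j)) = e j" "mix e c (sum_encode (Inr j)) = c j"
  by (simp_all add: mix_def)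

named_theorems dfn_intros

locale zf_model =
  fixes In :: "'a \<Rightarrow> 'a \<Rightarrow> bool"  (infix "\<epsilon>" 50)
  assumes axiom: "p \<in> ZF \<Longrightarrow> sat (\<epsilon>) (=) e p"
begin

abbreviation holds :: "(nat \<Rightarrow> 'a) \<Rightarrow> fm \<Rightarrow> bool" where
  "holds \<equiv> sat (\<epsilon>) (=)"

text \<open>\<open>P\<close> is a predicate of the metalogic on environments, so definability
  follows from the shape of \<open>P\<close> by closure rules and no formula has to be written out.
  The sequence \<open>c\<close> supplies the parameters.\<close>

definition dfn :: "((nat \<Rightarrow> 'a) \<Rightarrow> bool) \<Rightarrow> bool" where
  "dfn P \<longleftrightarrow> (\<exists>p c. \<forall>e. P e \<longleftrightarrow> holds (mix e c) p)"

text \<open>The graph of \<open>t\<close> is definable; variable \<open>0\<close> stands for the value.\<close>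

definition dft :: "((nat \<Rightarrow> 'a) \<Rightarrow> 'a) \<Rightarrow> bool" where
  "dft t \<longleftrightarrow> dfn (\<lambda>e. e 0 = t (\<lambda>i. e (Suc i)))"

lemma dfn_substitute:
  fixes s :: "nat \<Rightarrow> nat + 'a"
  assumes "dfn P"
  shows "dfn (\<lambda>e. P (\<lambda>i. case_sum e (\<lambda>a. a) (s i)))"
proof -
  obtain p c where p: "\<And>e. P e \<longleftrightarrow> holds (mix e c) p" using assms by (auto simp: dfn_def)
  \<comment> \<open>The constant replacing variable \<open>j\<close> becomes parameter
    \<open>sum_encode (Inl j)\<close>, and the old parameter \<open>j\<close> moves to
    \<open>sum_encode (Inr j)\<close>. At variables that are merely renamed, \<open>k\<close> is
    never read.\<close>
  define k where "k i = case_sum undefined (\<lambda>a. a) (s i)" for i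
  define r where "r i = sum_encode (case sum_decode i of
      Inl j \<Rightarrow> (case s j of Inl l \<Rightarrow> Inl l | Inr a \<Rightarrow> Inr (sum_encode (Inl j)))
    | Inr j \<Rightarrow> Inr (sum_encode (Inr j)))" for i
  have "mix e (mix k c) (r i) = mix (\<lambda>i. case_sum e (\<lambda>a. a) (s i)) c i" for e i
    by (cases "sum_decode i"; simp add: r_def; simp add: k_def mix_def split: sum.split)
  then have "P (\<lambda>i. case_sum e (\<lambda>a. a) (s i)) \<longleftrightarrow> holds (mix e (mix k c)) (ren r p)" for e
    by (simp add: p sat_ren)
  then show ?thesis unfolding dfn_def by blast
qed

lemma dfn_rename: "dfn P \<Longrightarrow> dfn (\<lambda>e. P (\<lambda>i. e (r i)))"
  using dfn_substitute[of P "\<lambda>i. Inl (r i)"] by simp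

lemma dfn_const [dfn_intros]: "dfn (\<lambda>e. b)"
proof (cases b)
  case True
  then show ?thesis unfolding dfn_def by (intro exI[of _ "Imp Fls Fls"]) simp
next
  case False
  then show ?thesis unfolding dfn_def by (intro exI[of _ "Fls"]) simp
qed

lemma dfn_imp [dfn_intros]:
  assumes "dfn P" "dfn Q"
  shows "dfn (\<lambda>e. P e \<longrightarrow> Q e)"
proof -
  obtain p c q c' where p: "\<And>e. P e \<longleftrightarrow> holds (mix e c) p" and q: "\<And>e. Q e \<longleftrightarrow> holds (mix e c') q"
    using assms by (auto simp: dfn_def)
  \<comment> \<open>The two parameter sequences are interleaved into \<open>mix c c'\<close>;
    \<open>r Inl\<close> and \<open>r Inr\<close> direct each formula to its own half.\<close>
  define r where "r f i = sum_encode (case sum_decode i of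
    Inl j \<Rightarrow> Inl j | Inr j \<Rightarrow> Inr (sum_encode (f j)))" for f :: "nat \<Rightarrow> nat + nat" and i
  have "mix e (mix c c') (r Inl i) = mix e c i" "mix e (mix c c') (r Inr i) = mix e c' i" for e i
    by (cases "sum_decode i"; simp add: r_def; simp add: mix_def)+
  then have "(P e \<longrightarrow> Q e) \<longleftrightarrow> holds (mix e (mix c c')) (Imp (ren (r Inl) p) (ren (r Inr) q))" for e
    by (simp add: p q sat_ren)
  then show ?thesis unfolding dfn_def by blast
qed

lemma dfn_not [dfn_intros]: "dfn P \<Longrightarrow> dfn (\<lambda>e. \<not> P e)"
  using dfn_imp[OF _ dfn_const[of False]] by simp

lemma dfn_disj [dfn_intros]: "dfn P \<Longrightarrow> dfn Q \<Longrightarrow> dfn (\<lambda>e. P e \<or> Q e)"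
  using dfn_imp[OF dfn_not[of P], of Q] by (simp add: imp_conv_disj)

lemma dfn_conj [dfn_intros]: "dfn P \<Longrightarrow> dfn Q \<Longrightarrow> dfn (\<lambda>e. P e \<and> Q e)"
  using dfn_not[OF dfn_disj[OF dfn_not[of P] dfn_not[of Q]]] by simp

lemma dfn_iff [dfn_intros]: "dfn P \<Longrightarrow> dfn Q \<Longrightarrow> dfn (\<lambda>e. P e \<longleftrightarrow> Q e)"
  using dfn_conj[OF dfn_imp[of P Q] dfn_imp[of Q P]] by (simp flip: iff_conv_conj_imp)

lemma dfn_all [dfn_intros]:
  assumes "dfn (\<lambda>e. P (\<lambda>i. e (Suc i)) (e 0))"
  shows "dfn (\<lambda>e. \<forall>x. P e x)"
proof -
  obtain p c where p: "\<And>e. P (\<lambda>i. e (Suc i)) (e 0) \<longleftrightarrow> holds (mix e c) p"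
    using assms by (auto simp: dfn_def)
  \<comment> \<open>The object-level quantifier shifts all of \<open>mix e c\<close>, whereas
    \<open>case_nat x e\<close> shifts the variables only; \<open>r\<close> translates between the
    two layouts.\<close>
  define r where "r i = (case sum_decode i of
      Inl j \<Rightarrow> case_nat 0 (\<lambda>k. Suc (sum_encode (Inl k))) j
    | Inr j \<Rightarrow> Suc (sum_encode (Inr j)))" for i
  have r: "(\<lambda>i. case_nat x (mix e c) (r i)) = mix (case_nat x e) c" for x e
  proof
    fix i
    show "case_nat x (mix e c) (r i) = mix (case_nat x e) c i"
      by (cases "sum_decode i"; simp add: r_def; simp add: mix_def split: nat.split)
  qed
  have "(\<forall>x. P e x) \<longleftrightarrow> holds (mix e c) (All (ren r p))" for e
    using p[of "case_nat _ e"] by (simp add: sat_ren r)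
  then show ?thesis unfolding dfn_def by blast
qed

lemma dfn_ex [dfn_intros]: "dfn (\<lambda>e. P (\<lambda>i. e (Suc i)) (e 0)) \<Longrightarrow> dfn (\<lambda>e. \<exists>x. P e x)"
  using dfn_not[OF dfn_all[OF dfn_not, of P]] by simp

lemma dfn_mem_var: "dfn (\<lambda>e. e i \<epsilon> e j)"
  unfolding dfn_def by (intro exI[of _ "Mem (sum_encode (Inl i)) (sum_encode (Inl j))"]) simp

lemma dfn_eq_var: "dfn (\<lambda>e. e i = e j)"
  unfolding dfn_def by (intro exI[of _ "Eq (sum_encode (Inl i)) (sum_encode (Inl j))"]) simp

lemma dft_var [dfn_intros]: "dft (\<lambda>e. e i)"
  unfolding dft_def by (rule dfn_eq_var)

lemma dft_const [dfn_intros]: "dft (\<lambda>e. a)"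
  using dfn_substitute[OF dfn_eq_var[of 0 1], of "case_nat (Inl 0) (\<lambda>_. Inr a)"]
  unfolding dft_def by simp

section \<open>Substitution of definable terms\<close>

lemma dfn_subst:
  assumes "dfn (\<lambda>e. P (\<lambda>i. e (Suc i)) (e 0))" "dft t"
  shows "dfn (\<lambda>e. P e (t e))"
proof -
  have "dfn (\<lambda>e. \<exists>x. x = t e \<and> P e x)"
    using assms unfolding dft_def by (intro dfn_ex dfn_conj)
  then show ?thesis by simp
qed

lemma dft_shift: "dft t \<Longrightarrow> dft (\<lambda>e. t (\<lambda>i. e (Suc i)))"
  unfolding dft_def by (drule dfn_rename[where r = "case_nat 0 (\<lambda>i. Suc (Suc i))"]) simp

text \<open>This rule and its analogues below carry definability of a new notion from the variables
  \<open>e 0\<close>, \<open>e 1\<close>, \<open>e 2\<close> over to arbitrary definable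
  arguments.\<close>

lemma dfn_subst1:
  assumes "dfn (\<lambda>e. P (e 0))" "dft t"
  shows "dfn (\<lambda>e. P (t e))"
  using dfn_subst[of "\<lambda>_ x. P x"] assms by simp

lemma dfn_subst2:
  assumes "dfn (\<lambda>e. P (e 0) (e 1))" "dft t" "dft u"
  shows "dfn (\<lambda>e. P (t e) (u e))"
proof (rule dfn_subst[of "\<lambda>e x. P x (u e)", OF _ assms(2)])
  show "dfn (\<lambda>e. P (e 0) (u (\<lambda>i. e (Suc i))))"
    by (rule dfn_subst[of "\<lambda>e x. P (e 0) x", OF _ dft_shift[OF assms(3)]])
      (use dfn_rename[OF assms(1), of "case_nat 1 (\<lambda>_. 0)"] in simp)
qed

lemma dfn_subst3:
  assumes "dfn (\<lambda>e. P (e 0) (e 1) (e 2))" "dft t" "dft u" "dft v"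
  shows "dfn (\<lambda>e. P (t e) (u e) (v e))"
proof (rule dfn_subst[of "\<lambda>e x. P x (u e) (v e)", OF _ assms(2)])
  show "dfn (\<lambda>e. P (e 0) (u (\<lambda>i. e (Suc i))) (v (\<lambda>i. e (Suc i))))"
  proof (rule dfn_subst[of "\<lambda>e x. P (e 0) x (v (\<lambda>i. e (Suc i)))", OF _ dft_shift[OF assms(3)]])
    show "dfn (\<lambda>e. P (e (Suc 0)) (e 0) (v (\<lambda>i. e (Suc (Suc i)))))"
      by (rule dfn_subst[of "\<lambda>e x. P (e (Suc 0)) (e 0) x", OF _ dft_shift[OF dft_shift[OF assms(4)]]])
        (use dfn_rename[OF assms(1), of "case_nat 2 (case_nat 1 (\<lambda>_. 0))"] in
          \<open>simp add: numeral_2_eq_2\<close>)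
  qed
qed

lemma dft_fun1: "dft (\<lambda>e. F (e 0)) \<Longrightarrow> dft t \<Longrightarrow> dft (\<lambda>e. F (t e))"
  unfolding dft_def[of "\<lambda>e. F (t e)"] dft_def[of "\<lambda>e. F (e 0)"]
  by (rule dfn_subst2[where P = "\<lambda>x y. x = F y"]) (simp, rule dft_var, rule dft_shift)

lemma dft_fun2:
  "dft (\<lambda>e. F (e 0) (e 1)) \<Longrightarrow> dft t \<Longrightarrow> dft u \<Longrightarrow> dft (\<lambda>e. F (t e) (u e))"
  unfolding dft_def[of "\<lambda>e. F (t e) (u e)"] dft_def[of "\<lambda>e. F (e 0) (e 1)"]
  by (rule dfn_subst3[where P = "\<lambda>x y z. x = F y z"])
    (simp add: numeral_2_eq_2, rule dft_var, (rule dft_shift, assumption)+)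

lemma dfn_mem [dfn_intros]: "dft t \<Longrightarrow> dft u \<Longrightarrow> dfn (\<lambda>e. t e \<epsilon> u e)"
  by (rule dfn_subst2[where P = "(\<epsilon>)", OF dfn_mem_var])

lemma dfn_eq [dfn_intros]: "dft t \<Longrightarrow> dft u \<Longrightarrow> dfn (\<lambda>e. t e = u e)"
  by (rule dfn_subst2[where P = "(=)", OF dfn_eq_var])


section \<open>Sets in a model of ZF\<close>

lemma set_eqI: "(\<And>u. u \<epsilon> x \<longleftrightarrow> u \<epsilon> y) \<Longrightarrow> x = y"
  using axiom[of "extensionality 0" undefined] by (simp add: ZF_def extensionality_def)

lemma set_eq_iff: "x = y \<longleftrightarrow> (\<forall>u. u \<epsilon> x \<longleftrightarrow> u \<epsilon> y)"
  using set_eqI by blast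

lemma foundation:
  assumes "u \<epsilon> x"
  obtains y where "y \<epsilon> x" "\<And>v. v \<epsilon> x \<Longrightarrow> \<not> v \<epsilon> y"
  using axiom[of "foundation 0" undefined] assms by (auto simp: ZF_def foundation_def)

lemma sat_fm_at:
  "sat R Q e (fm_at p [x] d) = sat R Q (case_nat (val e d x) (\<lambda>i. e (i + d))) p"
  "sat R Q e (fm_at p [x, y] d) = sat R Q (case_nat (val e d x) (case_nat (val e d y) (\<lambda>i. e (i + d)))) p"
  by (auto simp: fm_at_def sat_ren val_def less_Suc_eq split: nat.split
      intro!: arg_cong[of _ _ "\<lambda>e. sat R Q e p"])

lemma separation:
  assumes "dfn (\<lambda>e. P (e 0))"
  shows "\<exists>B. \<forall>x. x \<epsilon> B \<longleftrightarrow> x \<epsilon> A \<and> P x"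
proof -
  obtain p c where p: "\<And>e. P (e 0) \<longleftrightarrow> holds (mix e c) p" using assms by (auto simp: dfn_def)
  \<comment> \<open>The predicate depends on \<open>e 0\<close> alone, so all variables may be sent
    to index 0, which stands for the element of \<open>A\<close>. The parameters become the indices
    from 1 on, the free variables of the scheme.\<close>
  define r where "r i = (case sum_decode i of Inl j \<Rightarrow> 0 | Inr j \<Rightarrow> Suc j)" for i
  have "(\<lambda>i. case_nat x c (r i)) = mix (\<lambda>_. x) c" for x
    by (rule ext) (simp add: r_def mix_def split: sum.split)
  then have P: "holds (case_nat x c) (ren r p) \<longleftrightarrow> P x" for x
    using p[of "\<lambda>_. x"] by (simp add: sat_ren)
  have "holds c (separation (ren r p) 0)" by (rule axiom) (simp add: ZF_def)
  then show ?thesis by (simp add: separation_def sat_fm_at P)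
qed

lemma replacement:
  assumes F: "dft (\<lambda>e. F (e 0))"
  shows "\<exists>B. \<forall>y. y \<epsilon> B \<longleftrightarrow> (\<exists>x. x \<epsilon> A \<and> y = F x)"
proof -
  have "dfn (\<lambda>e. e 1 = F (e 0))" by (rule dfn_eq[OF dft_var F])
  then obtain p c where p: "\<And>e. e 1 = F (e 0) \<longleftrightarrow> holds (mix e c) p" by (auto simp: dfn_def)
  define r where "r i = (case sum_decode i of Inl j \<Rightarrow> case_nat 0 (\<lambda>_. 1) j | Inr j \<Rightarrow> Suc (Suc j))" for i
  have "(\<lambda>i. case_nat x (case_nat y c) (r i)) = mix (case_nat x (\<lambda>_. y)) c" for x y
    by (rule ext) (simp add: r_def mix_def split: sum.split nat.split)
  then have P: "holds (case_nat x (case_nat y c)) (ren r p) \<longleftrightarrow> y = F x" for x y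
    using p[of "case_nat x (\<lambda>_. y)"] by (simp add: sat_ren)
  have "holds c (replacement (ren r p) 0)" by (rule axiom) (simp add: ZF_def)
  then show ?thesis by (simp add: replacement_def sat_fm_at P)
qed

abbreviation sub :: "'a \<Rightarrow> 'a \<Rightarrow> bool" where
  "sub x y \<equiv> \<forall>u. u \<epsilon> x \<longrightarrow> u \<epsilon> y"

text \<open>A total operator that is meaningful only once existence is proved;
  \<open>mem_setof\<close> then gives the membership condition through which the operations below
  are used.\<close>

definition setof :: "('a \<Rightarrow> bool) \<Rightarrow> 'a" where
  "setof P = (THE x. \<forall>u. u \<epsilon> x \<longleftrightarrow> P u)"

lemma mem_setof: "\<exists>x. \<forall>u. u \<epsilon> x \<longleftrightarrow> P u \<Longrightarrow> u \<epsilon> setof P \<longleftrightarrow> P u"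
proof -
  assume "\<exists>x. \<forall>u. u \<epsilon> x \<longleftrightarrow> P u"
  then obtain x where x: "\<forall>u. u \<epsilon> x \<longleftrightarrow> P u" by blast
  have "setof P = x"
    unfolding setof_def by (rule the_equality[of _ x]) (use x in \<open>simp_all add: set_eq_iff\<close>)
  then show ?thesis using x by simp
qed

text \<open>By extensionality, being equal to \<open>t e\<close> means having exactly the members
  described by \<open>P e\<close>, so a definable membership condition makes the graph of
  \<open>t\<close> definable.\<close>

lemma dft_set:
  assumes "\<And>e u. u \<epsilon> t e \<longleftrightarrow> P e u" "dfn (\<lambda>e. P (\<lambda>i. e (Suc i)) (e 0))"
  shows "dft t"
proof -
  have "dfn (\<lambda>e. P (\<lambda>i. e (Suc (Suc i))) (e 0))"
    using dfn_rename[OF assms(2), of "case_nat 0 (\<lambda>i. Suc (Suc i))"] by simp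
  then have "dfn (\<lambda>e. \<forall>u. u \<epsilon> e 0 \<longleftrightarrow> P (\<lambda>i. e (Suc i)) u)"
    by (intro dfn_all dfn_iff dfn_mem dft_var)
  then show ?thesis by (simp add: dft_def set_eq_iff assms(1))
qed

section \<open>Elementary set operations\<close>

definition emp :: 'a where
  "emp = setof (\<lambda>_. False)"

lemma not_mem_emp [simp]: "\<not> u \<epsilon> emp"
  unfolding emp_def using separation[OF dfn_const[of False]] by (subst mem_setof) auto

lemma eq_emp_iff: "x = emp \<longleftrightarrow> (\<forall>u. \<not> u \<epsilon> x)"
  by (simp add: set_eq_iff)

definition upair :: "'a \<Rightarrow> 'a \<Rightarrow> 'a" where
  "upair a b = setof (\<lambda>u. u = a \<or> u = b)"

lemma mem_upair [simp]: "u \<epsilon> upair a b \<longleftrightarrow> u = a \<or> u = b"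
  unfolding upair_def using axiom[of "pairing 0" undefined]
  by (intro mem_setof) (simp add: ZF_def pairing_def)

lemma dft_upair [dfn_intros]: "dft t \<Longrightarrow> dft u \<Longrightarrow> dft (\<lambda>e. upair (t e) (u e))"
  by (rule dft_fun2[where F = upair]; (assumption | (rule dft_set, rule mem_upair, intro dfn_intros)))

definition bigcup :: "'a \<Rightarrow> 'a" where
  "bigcup x = setof (\<lambda>u. \<exists>v. v \<epsilon> x \<and> u \<epsilon> v)"

lemma mem_bigcup [simp]: "u \<epsilon> bigcup x \<longleftrightarrow> (\<exists>v. v \<epsilon> x \<and> u \<epsilon> v)"
  unfolding bigcup_def using axiom[of "union 0" undefined]
  by (intro mem_setof) (simp add: ZF_def union_def)

lemma dft_bigcup [dfn_intros]: "dft t \<Longrightarrow> dft (\<lambda>e. bigcup (t e))"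
  by (rule dft_fun1[where F = bigcup]; (assumption | (rule dft_set, rule mem_bigcup, intro dfn_intros)))

definition pow :: "'a \<Rightarrow> 'a" where
  "pow x = setof (\<lambda>u. sub u x)"

lemma mem_pow [simp]: "u \<epsilon> pow x \<longleftrightarrow> sub u x"
  unfolding pow_def using axiom[of "power_set 0" undefined]
  by (intro mem_setof) (simp add: ZF_def power_set_def subset_def)

lemma dft_pow [dfn_intros]: "dft t \<Longrightarrow> dft (\<lambda>e. pow (t e))"
  by (rule dft_fun1[where F = pow]; (assumption | (rule dft_set, rule mem_pow, intro dfn_intros)))

definition cup :: "'a \<Rightarrow> 'a \<Rightarrow> 'a" where
  "cup x y = bigcup (upair x y)"

lemma mem_cup [simp]: "u \<epsilon> cup x y \<longleftrightarrow> u \<epsilon> x \<or> u \<epsilon> y"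
  by (auto simp: cup_def)

lemma dft_cup [dfn_intros]: "dft t \<Longrightarrow> dft u \<Longrightarrow> dft (\<lambda>e. cup (t e) (u e))"
  unfolding cup_def by (intro dfn_intros)

lemma ex_remove: "\<exists>B. \<forall>x. x \<epsilon> B \<longleftrightarrow> x \<epsilon> A \<and> x \<noteq> a"
  by (rule separation) (intro dfn_intros)

definition ins :: "'a \<Rightarrow> 'a \<Rightarrow> 'a" where
  "ins a x = cup x (upair a a)"

lemma mem_ins [simp]: "u \<epsilon> ins a x \<longleftrightarrow> u \<epsilon> x \<or> u = a"
  by (simp add: ins_def)

lemma dft_ins [dfn_intros]: "dft t \<Longrightarrow> dft u \<Longrightarrow> dft (\<lambda>e. ins (t e) (u e))"
  unfolding ins_def by (intro dfn_intros)

definition pair :: "'a \<Rightarrow> 'a \<Rightarrow> 'a" where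
  "pair a b = upair (upair a a) (upair a b)"

lemma pair_iff [simp]: "pair a b = pair c d \<longleftrightarrow> a = c \<and> b = d"
  unfolding pair_def by (metis mem_upair)

lemma dft_pair [dfn_intros]: "dft t \<Longrightarrow> dft u \<Longrightarrow> dft (\<lambda>e. pair (t e) (u e))"
  unfolding pair_def by (intro dfn_intros)

definition prd :: "'a \<Rightarrow> 'a \<Rightarrow> 'a" where
  "prd A B = setof (\<lambda>z. \<exists>x y. x \<epsilon> A \<and> y \<epsilon> B \<and> z = pair x y)"

text \<open>Kuratowski pairs over \<open>A\<close> and \<open>B\<close> are sets of subsets of
  \<open>cup A B\<close>, so its double power set is a bound for separation.\<close>

lemma mem_prd: "z \<epsilon> prd A B \<longleftrightarrow> (\<exists>x y. x \<epsilon> A \<and> y \<epsilon> B \<and> z = pair x y)"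
  unfolding prd_def
proof (rule mem_setof)
  have "dfn (\<lambda>e. \<exists>x y. x \<epsilon> A \<and> y \<epsilon> B \<and> e 0 = pair x y)" by (intro dfn_intros)
  from separation[OF this, of "pow (pow (cup A B))"]
  obtain C where C: "z \<epsilon> C \<longleftrightarrow> z \<epsilon> pow (pow (cup A B)) \<and> (\<exists>x y. x \<epsilon> A \<and> y \<epsilon> B \<and> z = pair x y)" for z
    by blast
  have "pair x y \<epsilon> pow (pow (cup A B))" if "x \<epsilon> A" "y \<epsilon> B" for x y
    using that by (auto simp: pair_def)
  then have "z \<epsilon> C \<longleftrightarrow> (\<exists>x y. x \<epsilon> A \<and> y \<epsilon> B \<and> z = pair x y)" for z
    unfolding C by blast
  then show "\<exists>C. \<forall>z. z \<epsilon> C \<longleftrightarrow> (\<exists>x y. x \<epsilon> A \<and> y \<epsilon> B \<and> z = pair x y)" by blast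
qed

lemma pair_mem_prd [simp]: "pair x y \<epsilon> prd A B \<longleftrightarrow> x \<epsilon> A \<and> y \<epsilon> B"
  by (auto simp: mem_prd)

lemma dft_prd [dfn_intros]: "dft t \<Longrightarrow> dft u \<Longrightarrow> dft (\<lambda>e. prd (t e) (u e))"
  by (rule dft_fun2[where F = prd]; (assumption | (rule dft_set, rule mem_prd, intro dfn_intros)))

subsection \<open>Functions\<close>

definition isfun :: "'a \<Rightarrow> 'a \<Rightarrow> 'a \<Rightarrow> bool" where
  "isfun f A B \<longleftrightarrow> (\<forall>z. z \<epsilon> f \<longrightarrow> (\<exists>x y. x \<epsilon> A \<and> y \<epsilon> B \<and> z = pair x y)) \<and>
     (\<forall>x. x \<epsilon> A \<longrightarrow> (\<exists>y. \<forall>z. pair x z \<epsilon> f \<longleftrightarrow> z = y))"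

lemma dfn_isfun [dfn_intros]:
  "dft t \<Longrightarrow> dft u \<Longrightarrow> dft v \<Longrightarrow> dfn (\<lambda>e. isfun (t e) (u e) (v e))"
  by (rule dfn_subst3[where P = isfun]; (assumption | (unfold isfun_def, intro dfn_intros)))

lemma isfun_memD:
  assumes "isfun f A B" "pair x y \<epsilon> f"
  shows "x \<epsilon> A \<and> y \<epsilon> B"
proof -
  have "\<exists>x' y'. x' \<epsilon> A \<and> y' \<epsilon> B \<and> pair x y = pair x' y'"
    using assms unfolding isfun_def by blast
  then show ?thesis by auto
qed

lemma isfun_ex: "isfun f A B \<Longrightarrow> x \<epsilon> A \<Longrightarrow> \<exists>y. pair x y \<epsilon> f"
  unfolding isfun_def by blast

lemma isfun_unique:
  assumes f: "isfun f A B" and y: "pair x y \<epsilon> f" and z: "pair x z \<epsilon> f"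
  shows "y = z"
proof -
  have "x \<epsilon> A" using isfun_memD[OF f y] by simp
  then obtain w where "\<forall>z. pair x z \<epsilon> f \<longleftrightarrow> z = w" using f unfolding isfun_def by blast
  then show ?thesis using y z by simp
qed

lemma isfun_sub_prd: "isfun f A B \<Longrightarrow> sub f (prd A B)"
  unfolding isfun_def by (simp add: mem_prd)

lemma isfunI:
  assumes "sub f (prd A B)" "\<And>x. x \<epsilon> A \<Longrightarrow> \<exists>y. pair x y \<epsilon> f"
    "\<And>x y z. pair x y \<epsilon> f \<Longrightarrow> pair x z \<epsilon> f \<Longrightarrow> y = z"
  shows "isfun f A B"
proof -
  have "\<exists>y. \<forall>z. pair x z \<epsilon> f \<longleftrightarrow> z = y" if "x \<epsilon> A" for x
    using assms(2)[OF that] assms(3)[of x] by blast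
  then show ?thesis using assms(1) by (simp add: isfun_def mem_prd)
qed

lemma all_eq_iff_eq: "(\<forall>z. z = x \<longleftrightarrow> z = y) \<longleftrightarrow> y = x"
  by blast

text \<open>The junk value of \<open>app f x\<close> is the empty set.\<close>

definition app :: "'a \<Rightarrow> 'a \<Rightarrow> 'a" where
  "app f x = setof (\<lambda>u. \<exists>y. (\<forall>z. pair x z \<epsilon> f \<longleftrightarrow> z = y) \<and> u \<epsilon> y)"

text \<open>A description by members is what \<open>dft_set\<close> asks for. The set exists in
  either case: it is the unique value if there is one, and \<open>emp\<close> otherwise.\<close>

lemma mem_app: "u \<epsilon> app f x \<longleftrightarrow> (\<exists>y. (\<forall>z. pair x z \<epsilon> f \<longleftrightarrow> z = y) \<and> u \<epsilon> y)"
  unfolding app_def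
proof (rule mem_setof, cases "\<exists>y. \<forall>z. pair x z \<epsilon> f \<longleftrightarrow> z = y")
  case True
  then obtain y where "\<forall>z. pair x z \<epsilon> f \<longleftrightarrow> z = y" by blast
  then have "(\<exists>y. (\<forall>z. pair x z \<epsilon> f \<longleftrightarrow> z = y) \<and> u \<epsilon> y) \<longleftrightarrow> u \<epsilon> y" for u
    by (simp add: all_eq_iff_eq)
  then show "\<exists>C. \<forall>u. u \<epsilon> C \<longleftrightarrow> (\<exists>y. (\<forall>z. pair x z \<epsilon> f \<longleftrightarrow> z = y) \<and> u \<epsilon> y)" by blast
next
  case False
  then show "\<exists>C. \<forall>u. u \<epsilon> C \<longleftrightarrow> (\<exists>y. (\<forall>z. pair x z \<epsilon> f \<longleftrightarrow> z = y) \<and> u \<epsilon> y)"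
    by (intro exI[of _ emp]) simp
qed

lemma dft_app [dfn_intros]: "dft t \<Longrightarrow> dft u \<Longrightarrow> dft (\<lambda>e. app (t e) (u e))"
  by (rule dft_fun2[where F = app]; (assumption | (rule dft_set, rule mem_app, intro dfn_intros)))

lemma pair_mem_isfun:
  assumes "isfun f A B" "x \<epsilon> A"
  shows "pair x y \<epsilon> f \<longleftrightarrow> y = app f x"
proof -
  obtain y' where y': "\<forall>z. pair x z \<epsilon> f \<longleftrightarrow> z = y'" using assms unfolding isfun_def by blast
  have "app f x = y'" by (rule set_eqI) (simp add: mem_app y' all_eq_iff_eq)
  then show ?thesis using y' by simp
qed

lemma app_mem: "isfun f A B \<Longrightarrow> x \<epsilon> A \<Longrightarrow> app f x \<epsilon> B"
  using pair_mem_isfun isfun_memD by blast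

lemma ex_isfun:
  assumes "dft (\<lambda>e. F (e 0))" "\<And>x. x \<epsilon> A \<Longrightarrow> F x \<epsilon> B"
  shows "\<exists>f. isfun f A B \<and> (\<forall>x y. pair x y \<epsilon> f \<longleftrightarrow> x \<epsilon> A \<and> y = F x)"
proof -
  have "dfn (\<lambda>e. \<exists>x. e 0 = pair x (F x))" by (intro dfn_intros dft_fun1[OF assms(1)])
  from separation[OF this, of "prd A B"]
  obtain f where f: "\<And>z. z \<epsilon> f \<longleftrightarrow> z \<epsilon> prd A B \<and> (\<exists>x. z = pair x (F x))" by blast
  have p: "pair x y \<epsilon> f \<longleftrightarrow> x \<epsilon> A \<and> y = F x" for x y using assms(2) by (auto simp: f)
  have "isfun f A B" by (rule isfunI) (simp_all add: f assms(2))
  then show ?thesis using p by blast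
qed

definition isinj :: "'a \<Rightarrow> 'a \<Rightarrow> 'a \<Rightarrow> bool" where
  "isinj f A B \<longleftrightarrow> isfun f A B \<and> (\<forall>x x' y. pair x y \<epsilon> f \<and> pair x' y \<epsilon> f \<longrightarrow> x = x')"

definition isbij :: "'a \<Rightarrow> 'a \<Rightarrow> 'a \<Rightarrow> bool" where
  "isbij f A B \<longleftrightarrow> isinj f A B \<and> (\<forall>y. y \<epsilon> B \<longrightarrow> (\<exists>x. pair x y \<epsilon> f))"

lemma dfn_isbij [dfn_intros]:
  "dft t \<Longrightarrow> dft u \<Longrightarrow> dft v \<Longrightarrow> dfn (\<lambda>e. isbij (t e) (u e) (v e))"
  by (rule dfn_subst3[where P = isbij];
      (assumption | (unfold isbij_def isinj_def, intro dfn_intros)))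

subsection \<open>Natural numbers\<close>

definition suc :: "'a \<Rightarrow> 'a" where
  "suc n = ins n n"

lemma mem_suc: "u \<epsilon> suc n \<longleftrightarrow> u \<epsilon> n \<or> u = n"
  by (simp add: suc_def)

lemma dft_suc [dfn_intros]: "dft t \<Longrightarrow> dft (\<lambda>e. suc (t e))"
  unfolding suc_def by (intro dfn_intros)

lemma not_mem_self: "\<not> x \<epsilon> x"
  by (rule foundation[of x "upair x x"]) auto

lemma mem_asym: "x \<epsilon> y \<Longrightarrow> \<not> y \<epsilon> x"
  by (rule foundation[of x "upair x y"]) auto

lemma suc_inj: "suc m = suc n \<Longrightarrow> m = n"
  using mem_asym mem_suc by metis

definition indset :: "'a \<Rightarrow> bool" where
  "indset w \<longleftrightarrow> emp \<epsilon> w \<and> (\<forall>x. x \<epsilon> w \<longrightarrow> suc x \<epsilon> w)"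

definition omega :: 'a where
  "omega = setof (\<lambda>n. \<forall>w. indset w \<longrightarrow> n \<epsilon> w)"

lemma ex_indset: "\<exists>w. indset w"
proof -
  have "holds undefined (infinity 0)" by (rule axiom) (simp add: ZF_def)
  then have "\<exists>w. (\<exists>z. (\<forall>u. \<not> u \<epsilon> z) \<and> z \<epsilon> w) \<and>
      (\<forall>x. x \<epsilon> w \<longrightarrow> (\<exists>y. (\<forall>u. u \<epsilon> y \<longleftrightarrow> u \<epsilon> x \<or> u = x) \<and> y \<epsilon> w))"
    by (simp add: infinity_def is_inductive_def is_empty_def is_succ_def)
  then show ?thesis by (simp add: indset_def eq_emp_iff[symmetric] mem_suc[symmetric] set_eq_iff[symmetric])
qed

lemma mem_omega: "n \<epsilon> omega \<longleftrightarrow> (\<forall>w. indset w \<longrightarrow> n \<epsilon> w)"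
  unfolding omega_def
proof (rule mem_setof)
  obtain w where w: "indset w" using ex_indset by blast
  have "dfn (\<lambda>e. \<forall>w. indset w \<longrightarrow> e 0 \<epsilon> w)" unfolding indset_def by (intro dfn_intros)
  from separation[OF this, of w] w show "\<exists>x. \<forall>n. n \<epsilon> x \<longleftrightarrow> (\<forall>w. indset w \<longrightarrow> n \<epsilon> w)" by blast
qed

lemma emp_omega [simp]: "emp \<epsilon> omega"
  by (simp add: mem_omega indset_def)

lemma suc_omega [simp]: "n \<epsilon> omega \<Longrightarrow> suc n \<epsilon> omega"
  by (simp add: mem_omega indset_def)

text \<open>The set \<open>omega\<close> of the model may have nonstandard elements, so induction is
  confined to definable \<open>P\<close>, for which separation yields an inductive set.\<close>

lemma omega_induct:
  assumes "n \<epsilon> omega" "dfn (\<lambda>e. P (e 0))" "P emp" "\<And>n. n \<epsilon> omega \<Longrightarrow> P n \<Longrightarrow> P (suc n)"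
  shows "P n"
proof -
  obtain B where B: "\<And>x. x \<epsilon> B \<longleftrightarrow> x \<epsilon> omega \<and> P x" using separation[OF assms(2)] by blast
  have "indset B" using assms(3,4) by (simp add: indset_def B)
  then show ?thesis using assms(1) B mem_omega by blast
qed

lemma omega_trans: "n \<epsilon> omega \<Longrightarrow> m \<epsilon> n \<Longrightarrow> k \<epsilon> m \<Longrightarrow> k \<epsilon> n"
proof -
  assume n: "n \<epsilon> omega"
  have "\<forall>m k. m \<epsilon> n \<longrightarrow> k \<epsilon> m \<longrightarrow> k \<epsilon> n"
    by (rule omega_induct[OF n]) (intro dfn_intros, auto simp: mem_suc)
  then show "m \<epsilon> n \<Longrightarrow> k \<epsilon> m \<Longrightarrow> k \<epsilon> n" by blast
qed

lemma omega_linear: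
  assumes "m \<epsilon> omega" "n \<epsilon> omega"
  shows "m \<epsilon> n \<or> m = n \<or> n \<epsilon> m"
proof -
  have zero: "m = emp \<or> emp \<epsilon> m" if "m \<epsilon> omega" for m
    by (rule omega_induct[OF that]) (intro dfn_intros, auto simp: mem_suc)
  have succ: "n \<epsilon> m \<longrightarrow> suc n \<epsilon> m \<or> suc n = m" if "m \<epsilon> omega" for m n
    by (rule omega_induct[OF that]) (intro dfn_intros, auto simp: mem_suc)
  have "\<forall>m. m \<epsilon> omega \<longrightarrow> m \<epsilon> n \<or> m = n \<or> n \<epsilon> m"
  proof (rule omega_induct[OF assms(2)])
    show "dfn (\<lambda>e. \<forall>m. m \<epsilon> omega \<longrightarrow> m \<epsilon> e 0 \<or> m = e 0 \<or> e 0 \<epsilon> m)" by (intro dfn_intros)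
  qed (use zero succ in \<open>auto simp: mem_suc\<close>)
  then show ?thesis using assms(1) by blast
qed

subsection \<open>Finite sets\<close>

definition Fin :: "'a \<Rightarrow> bool" where
  "Fin A \<longleftrightarrow> (\<exists>n f. n \<epsilon> omega \<and> isbij f n A)"

lemma dfn_Fin [dfn_intros]: "dft t \<Longrightarrow> dfn (\<lambda>e. Fin (t e))"
  by (rule dfn_subst1[where P = Fin]; (assumption | (unfold Fin_def, intro dfn_intros)))

lemma Fin_emp: "Fin emp"
proof -
  have "isbij emp emp emp" by (simp add: isbij_def isinj_def isfun_def)
  then show ?thesis unfolding Fin_def using emp_omega by blast
qed

lemma Fin_ins:
  assumes "Fin A"
  shows "Fin (ins a A)"
proof (cases "a \<epsilon> A")
  case True
  then have "ins a A = A" by (intro set_eqI) auto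
  then show ?thesis using assms by simp
next
  case False
  obtain n f where n: "n \<epsilon> omega" and f: "isbij f n A" using assms by (auto simp: Fin_def)
  have ff: "isfun f n A" and inj: "\<And>x x' y. pair x y \<epsilon> f \<Longrightarrow> pair x' y \<epsilon> f \<Longrightarrow> x = x'"
    and surj: "\<And>y. y \<epsilon> A \<Longrightarrow> \<exists>x. pair x y \<epsilon> f"
    using f by (auto simp: isbij_def isinj_def)
  note D = isfun_memD[OF ff]
  let ?g = "ins (pair n a) f"
  have "isfun ?g (suc n) (ins a A)"
  proof (rule isfunI)
    show "sub ?g (prd (suc n) (ins a A))"
      using isfun_sub_prd[OF ff] by (auto simp: mem_prd mem_suc)
    show "\<exists>y. pair x y \<epsilon> ?g" if "x \<epsilon> suc n" for x
      using that isfun_ex[OF ff] by (auto simp: mem_suc)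
    show "y = z" if "pair x y \<epsilon> ?g" "pair x z \<epsilon> ?g" for x y z
      using that isfun_unique[OF ff, of x y z] D[of x y] D[of x z] not_mem_self[of n] by auto
  qed
  moreover have "x = x'" if "pair x y \<epsilon> ?g" "pair x' y \<epsilon> ?g" for x x' y
    using that inj[of x y x'] D[of x y] D[of x' y] False by auto
  moreover have "\<exists>x. pair x y \<epsilon> ?g" if "y \<epsilon> ins a A" for y
    using that surj[of y] by auto
  ultimately have "isbij ?g (suc n) (ins a A)" unfolding isbij_def isinj_def by blast
  then show ?thesis unfolding Fin_def using n suc_omega by blast
qed

text \<open>The bijection loses its last pair \<open>pair n a\<close>; this turns induction on the
  size of a set into induction by insertion.\<close>

lemma bij_suc_decompose:
  assumes "isbij f (suc n) A"
  shows "\<exists>a B g. A = ins a B \<and> \<not> a \<epsilon> B \<and> isbij g n B"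
proof -
  have ff: "isfun f (suc n) A" and inj: "\<And>x x' y. pair x y \<epsilon> f \<Longrightarrow> pair x' y \<epsilon> f \<Longrightarrow> x = x'"
    and surj: "\<And>y. y \<epsilon> A \<Longrightarrow> \<exists>x. pair x y \<epsilon> f"
    using assms by (auto simp: isbij_def isinj_def)
  note D = isfun_memD[OF ff]
  obtain a where a: "pair n a \<epsilon> f" using isfun_ex[OF ff, of n] by (simp add: mem_suc) blast
  obtain B g where B: "\<And>x. x \<epsilon> B \<longleftrightarrow> x \<epsilon> A \<and> x \<noteq> a" and g: "\<And>x. x \<epsilon> g \<longleftrightarrow> x \<epsilon> f \<and> x \<noteq> pair n a"
    using ex_remove[of A a] ex_remove[of f "pair n a"] by blast
  have gD: "pair x y \<epsilon> g \<longleftrightarrow> pair x y \<epsilon> f \<and> x \<epsilon> n \<and> y \<epsilon> B" for x y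
  proof
    assume "pair x y \<epsilon> g"
    then have f: "pair x y \<epsilon> f" and ne: "x = n \<longrightarrow> y \<noteq> a" by (simp_all add: g)
    have "x \<noteq> n" using isfun_unique[OF ff a, of y] f ne by blast
    moreover have "y \<noteq> a" using inj[OF a, of x] f ne by blast
    ultimately show "pair x y \<epsilon> f \<and> x \<epsilon> n \<and> y \<epsilon> B" using D[OF f] f by (simp add: B mem_suc)
  next
    assume "pair x y \<epsilon> f \<and> x \<epsilon> n \<and> y \<epsilon> B"
    then show "pair x y \<epsilon> g" by (simp add: g B)
  qed
  have "isfun g n B"
  proof (rule isfunI)
    show "sub g (prd n B)"
    proof (intro allI impI)
      fix z assume z: "z \<epsilon> g"
      then have "z \<epsilon> prd (suc n) A" using isfun_sub_prd[OF ff] by (simp add: g)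
      then obtain x y where "z = pair x y" unfolding mem_prd by blast
      then show "z \<epsilon> prd n B" using z gD by simp
    qed
    show "\<exists>y. pair x y \<epsilon> g" if x: "x \<epsilon> n" for x
    proof -
      obtain y where "pair x y \<epsilon> f" using isfun_ex[OF ff, of x] x by (auto simp: mem_suc)
      moreover have "x \<noteq> n" using x not_mem_self by blast
      ultimately show ?thesis by (intro exI[of _ y]) (simp add: g)
    qed
    show "y = z" if "pair x y \<epsilon> g" "pair x z \<epsilon> g" for x y z
      using that isfun_unique[OF ff, of x y z] by (simp add: gD)
  qed
  moreover have "\<exists>x. pair x y \<epsilon> g" if "y \<epsilon> B" for y
  proof -
    obtain x where "pair x y \<epsilon> f" using \<open>y \<epsilon> B\<close> surj[of y] by (auto simp: B)
    then show ?thesis using \<open>y \<epsilon> B\<close> by (intro exI[of _ x]) (simp add: g B)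
  qed
  moreover have "x = x'" if "pair x y \<epsilon> g" "pair x' y \<epsilon> g" for x x' y
    using that inj[of x y x'] by (simp add: gD)
  ultimately have "isbij g n B" unfolding isbij_def isinj_def by blast
  moreover have "A = ins a B" using D[OF a] by (intro set_eqI) (auto simp: B)
  moreover have "\<not> a \<epsilon> B" by (simp add: B)
  ultimately show ?thesis by blast
qed

text \<open>Induction on the number of elements, with the set and the bijection quantified inside,
  because the smaller set comes with a bijection of its own.\<close>

lemma Fin_induct:
  assumes "Fin A" "dfn (\<lambda>e. P (e 0))" "P emp"
    "\<And>a A. Fin A \<Longrightarrow> \<not> a \<epsilon> A \<Longrightarrow> P A \<Longrightarrow> P (ins a A)"
  shows "P A"
proof -
  obtain n f where n: "n \<epsilon> omega" and f: "isbij f n A" using assms(1) by (auto simp: Fin_def)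
  have "\<forall>A f. isbij f n A \<longrightarrow> P A"
  proof (rule omega_induct[OF n])
    show "dfn (\<lambda>e. \<forall>A f. isbij f (e 0) A \<longrightarrow> P A)" by (intro dfn_intros dfn_subst1[OF assms(2)])
    show "\<forall>A f. isbij f emp A \<longrightarrow> P A"
    proof (intro allI impI)
      fix A f assume f: "isbij f emp A"
      have "\<not> y \<epsilon> A" for y
      proof
        assume "y \<epsilon> A"
        then obtain x where "pair x y \<epsilon> f" using f by (auto simp: isbij_def)
        then show False using f isfun_memD[of f emp A x y] by (simp add: isbij_def isinj_def)
      qed
      then show "P A" using assms(3) eq_emp_iff by metis
    qed
    show "\<forall>A f. isbij f (suc n) A \<longrightarrow> P A" if n: "n \<epsilon> omega" and IH: "\<forall>A f. isbij f n A \<longrightarrow> P A" for n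
    proof (intro allI impI)
      fix A f assume "isbij f (suc n) A"
      from bij_suc_decompose[OF this] obtain a B g where
        A: "A = ins a B" "\<not> a \<epsilon> B" and g: "isbij g n B" by blast
      have "Fin B" using n g unfolding Fin_def by blast
      then show "P A" using assms(4)[of B a] A IH g by simp
    qed
  qed
  then show ?thesis using f by blast
qed

lemma Fin_subset:
  assumes "Fin A" "sub B A"
  shows "Fin B"
proof -
  have "\<forall>B. sub B A \<longrightarrow> Fin B"
  proof (rule Fin_induct[OF assms(1)])
    show "dfn (\<lambda>e. \<forall>B. sub B (e 0) \<longrightarrow> Fin B)" by (intro dfn_intros)
    show "\<forall>B. sub B emp \<longrightarrow> Fin B" using Fin_emp by (simp add: eq_emp_iff[symmetric])
    fix a A assume IH: "\<forall>B. sub B A \<longrightarrow> Fin B"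
    show "\<forall>B. sub B (ins a A) \<longrightarrow> Fin B"
    proof (intro allI impI)
      fix B assume B: "sub B (ins a A)"
      obtain C where C: "\<And>x. x \<epsilon> C \<longleftrightarrow> x \<epsilon> B \<and> x \<noteq> a" using ex_remove[of B a] by blast
      have "sub C A" using B by (auto simp: C)
      then have FC: "Fin C" using IH by blast
      show "Fin B"
      proof (cases "a \<epsilon> B")
        case True
        then have "B = ins a C" by (intro set_eqI) (auto simp: C)
        then show ?thesis using Fin_ins[OF FC] by simp
      next
        case False
        then have "B = C" by (intro set_eqI) (auto simp: C)
        then show ?thesis using FC by simp
      qed
    qed
  qed
  then show ?thesis using assms(2) by blast
qed

lemma Fin_cup:
  assumes "Fin A" "Fin B"
  shows "Fin (cup A B)"
proof (rule Fin_induct[OF assms(1)])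
  show "dfn (\<lambda>e. Fin (cup (e 0) B))" by (intro dfn_intros)
  have "cup emp B = B" by (rule set_eqI) simp
  then show "Fin (cup emp B)" using assms(2) by simp
  fix a A assume "Fin (cup A B)"
  moreover have "cup (ins a A) B = ins a (cup A B)" by (rule set_eqI) auto
  ultimately show "Fin (cup (ins a A) B)" using Fin_ins by simp
qed

lemma Fin_bigcup:
  assumes "Fin A" "\<And>x. x \<epsilon> A \<Longrightarrow> Fin x"
  shows "Fin (bigcup A)"
proof -
  have "(\<forall>x. x \<epsilon> A \<longrightarrow> Fin x) \<longrightarrow> Fin (bigcup A)"
  proof (rule Fin_induct[OF assms(1)])
    show "dfn (\<lambda>e. (\<forall>x. x \<epsilon> e 0 \<longrightarrow> Fin x) \<longrightarrow> Fin (bigcup (e 0)))" by (intro dfn_intros)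
    have "bigcup emp = emp" by (rule set_eqI) simp
    then show "(\<forall>x. x \<epsilon> emp \<longrightarrow> Fin x) \<longrightarrow> Fin (bigcup emp)" using Fin_emp by simp
    fix a A assume "(\<forall>x. x \<epsilon> A \<longrightarrow> Fin x) \<longrightarrow> Fin (bigcup A)"
    moreover have "bigcup (ins a A) = cup (bigcup A) a" by (rule set_eqI) auto
    ultimately show "(\<forall>x. x \<epsilon> ins a A \<longrightarrow> Fin x) \<longrightarrow> Fin (bigcup (ins a A))"
      using Fin_cup by simp
  qed
  then show ?thesis using assms(2) by blast
qed

definition img :: "('a \<Rightarrow> 'a) \<Rightarrow> 'a \<Rightarrow> 'a" where
  "img F A = setof (\<lambda>y. \<exists>x. x \<epsilon> A \<and> y = F x)"

lemma mem_img:
  assumes "dft (\<lambda>e. F (e 0))"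
  shows "y \<epsilon> img F A \<longleftrightarrow> (\<exists>x. x \<epsilon> A \<and> y = F x)"
  unfolding img_def by (rule mem_setof[OF replacement[OF assms]])

lemma Fin_img:
  assumes F: "dft (\<lambda>e. F (e 0))" and "Fin A"
  shows "Fin (img F A)"
proof (rule Fin_induct[OF assms(2)])
  have "dft (\<lambda>e. img F (e 0))"
    by (rule dft_set, rule mem_img[OF F], intro dfn_intros dft_fun1[OF F])
  then show "dfn (\<lambda>e. Fin (img F (e 0)))" by (rule dfn_Fin)
  have "img F emp = emp" by (rule set_eqI) (simp add: mem_img[OF F])
  then show "Fin (img F emp)" using Fin_emp by simp
  fix a A assume "Fin (img F A)"
  moreover have "img F (ins a A) = ins (F a) (img F A)" by (rule set_eqI) (auto simp: mem_img[OF F])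
  ultimately show "Fin (img F (ins a A))" using Fin_ins by simp
qed

lemma Fin_pow:
  assumes "Fin A"
  shows "Fin (pow A)"
proof (rule Fin_induct[OF assms])
  show "dfn (\<lambda>e. Fin (pow (e 0)))" by (intro dfn_intros)
  have "pow emp = ins emp emp" by (rule set_eqI) (auto simp: eq_emp_iff)
  then show "Fin (pow emp)" using Fin_emp Fin_ins by simp
  fix a A assume A: "Fin (pow A)"
  have d: "dft (\<lambda>e. ins a (e 0))" by (intro dfn_intros)
  \<comment> \<open>A subset of \<open>ins a A\<close> either omits \<open>a\<close> or is
    \<open>ins a C\<close> for a subset \<open>C\<close> of \<open>A\<close>, so two copies of
    \<open>pow A\<close> cover everything.\<close>
  have "sub (pow (ins a A)) (cup (pow A) (img (ins a) (pow A)))"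
  proof (intro allI impI)
    fix B assume B: "B \<epsilon> pow (ins a A)"
    show "B \<epsilon> cup (pow A) (img (ins a) (pow A))"
    proof (cases "a \<epsilon> B")
      case True
      obtain C where C: "\<And>x. x \<epsilon> C \<longleftrightarrow> x \<epsilon> B \<and> x \<noteq> a" using ex_remove[of B a] by blast
      have "B = ins a C" using True by (intro set_eqI) (auto simp: C)
      moreover have "C \<epsilon> pow A" using B by (auto simp: C)
      ultimately show ?thesis unfolding mem_cup mem_img[OF d] by blast
    qed (use B in auto)
  qed
  then show "Fin (pow (ins a A))" by (rule Fin_subset[rotated]) (intro Fin_cup A Fin_img d)
qed

lemma Fin_prd:
  assumes "Fin A" "Fin B"
  shows "Fin (prd A B)"
proof (rule Fin_induct[OF assms(1)])
  show "dfn (\<lambda>e. Fin (prd (e 0) B))" by (intro dfn_intros)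
  have "prd emp B = emp" by (rule set_eqI) (simp add: mem_prd)
  then show "Fin (prd emp B)" using Fin_emp by simp
  fix a A assume A: "Fin (prd A B)"
  have d: "dft (\<lambda>e. pair a (e 0))" by (intro dfn_intros)
  have "prd (ins a A) B = cup (prd A B) (img (pair a) B)"
    by (rule set_eqI) (auto simp: mem_prd mem_img[OF d])
  then show "Fin (prd (ins a A) B)" by (simp only:) (intro Fin_cup A Fin_img d assms(2))
qed

text \<open>Induction on \<open>A\<close>, extending the function by one pair at a time, proves this
  in ZF alone. It is used to see that the sets \<open>\<Phi> n\<close> of extension functions are
  nonempty.\<close>

lemma finite_choice:
  assumes "Fin A" and R: "dfn (\<lambda>e. R (e 0) (e 1))" and ex: "\<And>x. x \<epsilon> A \<Longrightarrow> \<exists>y. y \<epsilon> B \<and> R x y"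
  shows "\<exists>f. isfun f A B \<and> (\<forall>x y. pair x y \<epsilon> f \<longrightarrow> R x y)"
proof -
  have "(\<forall>x. x \<epsilon> A \<longrightarrow> (\<exists>y. y \<epsilon> B \<and> R x y)) \<longrightarrow> (\<exists>f. isfun f A B \<and> (\<forall>x y. pair x y \<epsilon> f \<longrightarrow> R x y))"
  proof (rule Fin_induct[OF assms(1)])
    show "dfn (\<lambda>e. (\<forall>x. x \<epsilon> e 0 \<longrightarrow> (\<exists>y. y \<epsilon> B \<and> R x y)) \<longrightarrow>
        (\<exists>f. isfun f (e 0) B \<and> (\<forall>x y. pair x y \<epsilon> f \<longrightarrow> R x y)))"
      by (intro dfn_intros dfn_subst2[OF R])
    show "(\<forall>x. x \<epsilon> emp \<longrightarrow> (\<exists>y. y \<epsilon> B \<and> R x y)) \<longrightarrow> (\<exists>f. isfun f emp B \<and> (\<forall>x y. pair x y \<epsilon> f \<longrightarrow> R x y))"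
      by (intro impI exI[of _ emp]) (simp add: isfun_def)
    fix a A
    assume aA: "\<not> a \<epsilon> A"
      and IH: "(\<forall>x. x \<epsilon> A \<longrightarrow> (\<exists>y. y \<epsilon> B \<and> R x y)) \<longrightarrow> (\<exists>f. isfun f A B \<and> (\<forall>x y. pair x y \<epsilon> f \<longrightarrow> R x y))"
    show "(\<forall>x. x \<epsilon> ins a A \<longrightarrow> (\<exists>y. y \<epsilon> B \<and> R x y)) \<longrightarrow>
        (\<exists>f. isfun f (ins a A) B \<and> (\<forall>x y. pair x y \<epsilon> f \<longrightarrow> R x y))"
    proof
      assume *: "\<forall>x. x \<epsilon> ins a A \<longrightarrow> (\<exists>y. y \<epsilon> B \<and> R x y)"
      then obtain f where f: "isfun f A B" "\<forall>x y. pair x y \<epsilon> f \<longrightarrow> R x y" using IH by auto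
      obtain b where b: "b \<epsilon> B" "R a b" using * by auto
      let ?g = "ins (pair a b) f"
      have "isfun ?g (ins a A) B"
      proof (rule isfunI)
        show "sub ?g (prd (ins a A) B)"
          using isfun_sub_prd[OF f(1)] b(1) by (auto simp: mem_prd)
        show "\<exists>y. pair x y \<epsilon> ?g" if "x \<epsilon> ins a A" for x
          using that isfun_ex[OF f(1)] by auto
        show "y = z" if "pair x y \<epsilon> ?g" "pair x z \<epsilon> ?g" for x y z
          using that isfun_unique[OF f(1), of x y z] isfun_memD[OF f(1), of x y] isfun_memD[OF f(1), of x z] aA by auto
      qed
      moreover have "\<forall>x y. pair x y \<epsilon> ?g \<longrightarrow> R x y" using f(2) b(2) by simp
      ultimately show "\<exists>f. isfun f (ins a A) B \<and> (\<forall>x y. pair x y \<epsilon> f \<longrightarrow> R x y)" by blast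
    qed
  qed
  then show ?thesis using ex by blast
qed

subsection \<open>Recursion\<close>

text \<open>The function is the least set of pairs that contains the start and is closed under the
  step. \<open>C\<close> provides the bound for separation, and uniqueness of values comes from
  leastness.\<close>

lemma recursion:
  assumes G: "dft (\<lambda>e. G (e 0) (e 1))" and x0: "x0 \<epsilon> C"
    and step: "\<And>n x. n \<epsilon> omega \<Longrightarrow> x \<epsilon> C \<Longrightarrow> G n x \<epsilon> C"
  shows "\<exists>f. isfun f omega C \<and> app f emp = x0 \<and> (\<forall>n. n \<epsilon> omega \<longrightarrow> app f (suc n) = G n (app f n))"
proof -
  define cl where "cl X \<longleftrightarrow> pair emp x0 \<epsilon> X \<and>
    (\<forall>n x. n \<epsilon> omega \<and> x \<epsilon> C \<and> pair n x \<epsilon> X \<longrightarrow> pair (suc n) (G n x) \<epsilon> X)" for X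
  have "dfn (\<lambda>e. \<forall>X. cl X \<longrightarrow> e 0 \<epsilon> X)"
    unfolding cl_def by (intro dfn_intros dft_fun2[OF G])
  from separation[OF this, of "prd omega C"]
  obtain f where f: "\<And>z. z \<epsilon> f \<longleftrightarrow> z \<epsilon> prd omega C \<and> (\<forall>X. cl X \<longrightarrow> z \<epsilon> X)" by blast
  have f0: "pair emp x0 \<epsilon> f" using x0 by (simp add: f cl_def)
  have fs: "pair (suc n) (G n x) \<epsilon> f" if "pair n x \<epsilon> f" for n x
    using that step by (auto simp: f cl_def)
  have cl_f: "cl f" using f0 fs by (simp add: cl_def)
  have f_sub: "cl X \<Longrightarrow> z \<epsilon> f \<Longrightarrow> z \<epsilon> X" for X z by (simp add: f)
  \<comment> \<open>A second value at \<open>emp\<close> could be deleted without destroying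
    closure, since no step leads to a pair over \<open>emp\<close>.\<close>
  have u0: "x = x0" if "pair emp x \<epsilon> f" for x
  proof (rule ccontr)
    assume ne: "x \<noteq> x0"
    obtain X where X: "\<And>z. z \<epsilon> X \<longleftrightarrow> z \<epsilon> f \<and> z \<noteq> pair emp x" using ex_remove[of f "pair emp x"] by blast
    have "suc n \<noteq> emp" for n by (metis mem_suc not_mem_emp)
    then have "cl X" using cl_f ne by (auto simp: cl_def X)
    then show False using f_sub[OF _ that] X by blast
  qed
  \<comment> \<open>A value other than \<open>G n x\<close> at \<open>suc n\<close> could be deleted
    as well: \<open>suc\<close> is injective, so only pairs over \<open>n\<close> lead there, and by
    assumption their second component is \<open>x\<close>.\<close>
  have us: "y = G n x" if y: "pair (suc n) y \<epsilon> f" and u: "\<And>x'. pair n x' \<epsilon> f \<Longrightarrow> x' = x" for n x y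
  proof (rule ccontr)
    assume ne: "y \<noteq> G n x"
    obtain X where X: "\<And>z. z \<epsilon> X \<longleftrightarrow> z \<epsilon> f \<and> z \<noteq> pair (suc n) y" using ex_remove[of f "pair (suc n) y"] by blast
    have e: "emp \<noteq> suc n" by (metis mem_suc not_mem_emp)
    have "pair (suc m) (G m x') \<epsilon> X" if "pair m x' \<epsilon> X" for m x'
      using that u ne suc_inj fs by (auto simp: X)
    then have "cl X" using f0 e by (simp add: cl_def X)
    then show False using f_sub[OF _ y] X by blast
  qed
  have fn: "\<exists>y. \<forall>z. pair n z \<epsilon> f \<longleftrightarrow> z = y" if "n \<epsilon> omega" for n
  proof (rule omega_induct[OF that])
    show "dfn (\<lambda>e. \<exists>y. \<forall>z. pair (e 0) z \<epsilon> f \<longleftrightarrow> z = y)" by (intro dfn_intros)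
    show "\<exists>y. \<forall>z. pair emp z \<epsilon> f \<longleftrightarrow> z = y" using f0 u0 by blast
    fix n assume "\<exists>y. \<forall>z. pair n z \<epsilon> f \<longleftrightarrow> z = y"
    then obtain y where "\<And>z. pair n z \<epsilon> f \<longleftrightarrow> z = y" by blast
    then have "\<forall>z. pair (suc n) z \<epsilon> f \<longleftrightarrow> z = G n y" using us[of n _ y] fs by blast
    then show "\<exists>y. \<forall>z. pair (suc n) z \<epsilon> f \<longleftrightarrow> z = y" by blast
  qed
  have f_fun: "isfun f omega C"
    unfolding isfun_def using fn by (simp add: f mem_prd)
  have "app f emp = x0" using f0 pair_mem_isfun[OF f_fun] by simp
  moreover have "app f (suc n) = G n (app f n)" if "n \<epsilon> omega" for n
    using fs[of n "app f n"] pair_mem_isfun[OF f_fun] that by simp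
  ultimately show ?thesis using f_fun by blast
qed

section \<open>The set-theoretic notions in a model\<close>

text \<open>With true equality and extensionality, the relations of the object language become
  equations between the operations of the model. This rule supersedes \<open>sat_is_upair\<close>,
  which holds for any \<open>Q\<close>.\<close>

lemma holds_is_upair [simp]:
  "z < d \<Longrightarrow> x < d \<Longrightarrow> y < d \<Longrightarrow>
    holds e (is_upair z x y d) \<longleftrightarrow> val e d z = upair (val e d x) (val e d y)"
  by (simp add: set_eq_iff)

declare sat_is_upair [simp del]

lemma holds_subset [simp]:
  "x < d \<Longrightarrow> y < d \<Longrightarrow> holds e (subset x y d) \<longleftrightarrow> sub (val e d x) (val e d y)"
  by (simp add: subset_def)

lemma holds_is_empty [simp]: "x < d \<Longrightarrow> holds e (is_empty x d) \<longleftrightarrow> val e d x = emp"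
  by (simp add: is_empty_def eq_emp_iff)

lemma holds_is_opair [simp]:
  "z < d \<Longrightarrow> x < d \<Longrightarrow> y < d \<Longrightarrow>
    holds e (is_opair z x y d) \<longleftrightarrow> val e d z = pair (val e d x) (val e d y)"
  by (simp add: is_opair_def pair_def)

lemma holds_opair_in [simp]:
  "x < d \<Longrightarrow> y < d \<Longrightarrow> r < d \<Longrightarrow>
    holds e (opair_in x y r d) \<longleftrightarrow> pair (val e d x) (val e d y) \<epsilon> val e d r"
  by (simp add: opair_in_def)

lemma holds_is_fun [simp]:
  "f < d \<Longrightarrow> A < d \<Longrightarrow> B < d \<Longrightarrow>
    holds e (is_fun f A B d) \<longleftrightarrow> isfun (val e d f) (val e d A) (val e d B)"
  by (simp add: is_fun_def isfun_def less_Suc_eq)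

lemma holds_is_inj [simp]:
  "f < d \<Longrightarrow> A < d \<Longrightarrow> B < d \<Longrightarrow>
    holds e (is_inj f A B d) \<longleftrightarrow> isinj (val e d f) (val e d A) (val e d B)"
  by (simp add: is_inj_def isinj_def)

lemma holds_is_bij [simp]:
  "f < d \<Longrightarrow> A < d \<Longrightarrow> B < d \<Longrightarrow>
    holds e (is_bij f A B d) \<longleftrightarrow> isbij (val e d f) (val e d A) (val e d B)"
  by (simp add: is_bij_def isbij_def)

lemma holds_is_succ [simp]:
  "y < d \<Longrightarrow> x < d \<Longrightarrow> holds e (is_succ y x d) \<longleftrightarrow> val e d y = suc (val e d x)"
  by (simp add: is_succ_def set_eq_iff mem_suc)

lemma holds_is_inductive [simp]: "w < d \<Longrightarrow> holds e (is_inductive w d) \<longleftrightarrow> indset (val e d w)"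
  by (simp add: is_inductive_def indset_def)

lemma indset_omega: "indset omega"
  by (simp add: indset_def)

lemma omega_least: "indset w \<Longrightarrow> sub omega w"
  by (simp add: mem_omega)

lemma holds_is_omega [simp]: "w < d \<Longrightarrow> holds e (is_omega w d) \<longleftrightarrow> val e d w = omega"
proof -
  have "indset x \<and> (\<forall>v. indset v \<longrightarrow> sub x v) \<longleftrightarrow> x = omega" for x
    using indset_omega omega_least set_eqI[of x omega] by blast
  then show "w < d \<Longrightarrow> ?thesis" by (simp add: is_omega_def)
qed

lemma holds_fin [simp]: "A < d \<Longrightarrow> holds e (fin A d) \<longleftrightarrow> Fin (val e d A)"
  by (simp add: fin_def Fin_def)

lemma holds_denumerable [simp]:
  "A < d \<Longrightarrow> holds e (denumerable A d) \<longleftrightarrow> (\<exists>f. isbij f omega (val e d A))"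
  by (simp add: denumerable_def)

lemma holds_choice_function [simp]:
  "c < d \<Longrightarrow> F < d \<Longrightarrow> holds e (choice_function c F d) \<longleftrightarrow>
    (\<exists>U. isfun (val e d c) (val e d F) U) \<and> (\<forall>x y. pair x y \<epsilon> val e d c \<longrightarrow> y \<epsilon> x)"
  by (simp add: choice_function_def)

definition fin_choice :: bool where
  "fin_choice \<longleftrightarrow> (\<forall>F. (\<exists>f. isbij f omega F) \<and> (\<forall>x. x \<epsilon> F \<longrightarrow> x \<noteq> emp \<and> Fin x) \<longrightarrow>
     (\<exists>c. (\<exists>U. isfun c F U) \<and> (\<forall>x y. pair x y \<epsilon> c \<longrightarrow> y \<epsilon> x)))"

lemma holds_AC_fin_omega [simp]: "holds e (AC_fin_omega d) \<longleftrightarrow> fin_choice"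
  by (simp add: AC_fin_omega_def fin_choice_def)

lemma holds_adj [simp]:
  "E < d \<Longrightarrow> x < d \<Longrightarrow> y < d \<Longrightarrow>
    holds e (adj E x y d) \<longleftrightarrow> upair (val e d x) (val e d y) \<epsilon> val e d E"
  by (simp add: adj_def)

definition isgraph :: "'a \<Rightarrow> 'a \<Rightarrow> bool" where
  "isgraph V E \<longleftrightarrow> (\<forall>e. e \<epsilon> E \<longrightarrow> (\<exists>u v. u \<epsilon> V \<and> v \<epsilon> V \<and> u \<noteq> v \<and> e = upair u v))"

lemma holds_graph [simp]:
  "V < d \<Longrightarrow> E < d \<Longrightarrow> holds e (graph V E d) \<longleftrightarrow> isgraph (val e d V) (val e d E)"
  by (simp add: graph_def isgraph_def)

definition locfin :: "'a \<Rightarrow> 'a \<Rightarrow> bool" where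
  "locfin V E \<longleftrightarrow> (\<forall>v. v \<epsilon> V \<longrightarrow> (\<exists>D. (\<forall>e. e \<epsilon> D \<longleftrightarrow> e \<epsilon> E \<and> v \<epsilon> e) \<and> Fin D))"

lemma holds_locally_finite [simp]:
  "V < d \<Longrightarrow> E < d \<Longrightarrow> holds e (locally_finite V E d) \<longleftrightarrow> locfin (val e d V) (val e d E)"
  by (simp add: locally_finite_def locfin_def less_Suc_eq)

definition ispath :: "'a \<Rightarrow> 'a \<Rightarrow> 'a \<Rightarrow> 'a \<Rightarrow> 'a \<Rightarrow> 'a \<Rightarrow> bool" where
  "ispath V E p n u v \<longleftrightarrow> isinj p (suc n) V \<and> pair emp u \<epsilon> p \<and> pair n v \<epsilon> p \<and>
     (\<forall>i. i \<epsilon> n \<longrightarrow> (\<exists>x y. pair i x \<epsilon> p \<and> pair (suc i) y \<epsilon> p \<and> upair x y \<epsilon> E))"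

lemma holds_is_path [simp]:
  "V < d \<Longrightarrow> E < d \<Longrightarrow> p < d \<Longrightarrow> n < d \<Longrightarrow> u < d \<Longrightarrow> v < d \<Longrightarrow> holds e (is_path V E p n u v d) \<longleftrightarrow>
    ispath (val e d V) (val e d E) (val e d p) (val e d n) (val e d u) (val e d v)"
  by (simp add: is_path_def ispath_def less_Suc_eq)

definition connected :: "'a \<Rightarrow> 'a \<Rightarrow> bool" where
  "connected V E \<longleftrightarrow> (\<forall>u v. u \<epsilon> V \<and> v \<epsilon> V \<longrightarrow> (\<exists>n p. n \<epsilon> omega \<and> ispath V E p n u v))"

lemma holds_connected_graph [simp]:
  "V < d \<Longrightarrow> E < d \<Longrightarrow> holds e (connected_graph V E d) \<longleftrightarrow> connected (val e d V) (val e d E)"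
  by (simp add: connected_graph_def connected_def less_Suc_eq)

lemma holds_subgraph [simp]:
  "V' < d \<Longrightarrow> E' < d \<Longrightarrow> V < d \<Longrightarrow> E < d \<Longrightarrow> holds e (subgraph V' E' V E d) \<longleftrightarrow>
    isgraph (val e d V') (val e d E') \<and> sub (val e d V') (val e d V) \<and> sub (val e d E') (val e d E)"
  by (simp add: subgraph_def)

definition ishom :: "'a \<Rightarrow> 'a \<Rightarrow> 'a \<Rightarrow> 'a \<Rightarrow> 'a \<Rightarrow> bool" where
  "ishom f V E W S \<longleftrightarrow> isfun f V W \<and>
     (\<forall>u v. upair u v \<epsilon> E \<longrightarrow> (\<exists>x y. pair u x \<epsilon> f \<and> pair v y \<epsilon> f \<and> upair x y \<epsilon> S))"

lemma holds_is_hom [simp]: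
  "f < d \<Longrightarrow> V < d \<Longrightarrow> E < d \<Longrightarrow> W < d \<Longrightarrow> S < d \<Longrightarrow> holds e (is_hom f V E W S d) \<longleftrightarrow>
    ishom (val e d f) (val e d V) (val e d E) (val e d W) (val e d S)"
  by (simp add: is_hom_def ishom_def)


section \<open>Choosing from a sequence of finite sets\<close>

lemma Fin_upair: "Fin (upair a b)"
proof -
  have "upair a b = ins a (ins b emp)" by (rule set_eqI) auto
  then show ?thesis using Fin_emp Fin_ins by simp
qed

text \<open>The sets \<open>{n} \<times> X n\<close> form a denumerable family even when \<open>X\<close> is not injective.\<close>

lemma choice_sequence:
  assumes AC: fin_choice and X: "dft (\<lambda>e. X (e 0))"
    and fin_X: "\<And>n. n \<epsilon> omega \<Longrightarrow> Fin (X n)" and ne: "\<And>n. n \<epsilon> omega \<Longrightarrow> \<exists>x. x \<epsilon> X n"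
  shows "\<exists>c. \<forall>n. n \<epsilon> omega \<longrightarrow> app c n \<epsilon> X n"
proof -
  define Y where "Y n = prd (upair n n) (X n)" for n
  have Y: "dft (\<lambda>e. Y (e 0))" unfolding Y_def by (intro dfn_intros X)
  have mem_Y: "pair m x \<epsilon> Y n \<longleftrightarrow> m = n \<and> x \<epsilon> X n" for m n x by (simp add: Y_def)
  let ?F = "img Y omega"
  have YF: "n \<epsilon> omega \<Longrightarrow> Y n \<epsilon> ?F" for n unfolding mem_img[OF Y] by blast
  obtain f where f: "isfun f omega ?F" and pf: "\<And>x y. pair x y \<epsilon> f \<longleftrightarrow> x \<epsilon> omega \<and> y = Y x"
    using ex_isfun[OF Y YF] by blast
  \<comment> \<open>Nonemptiness is essential for injectivity: an element of \<open>Y x\<close>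
    reveals \<open>x\<close> as its first component.\<close>
  have "x = x'" if "pair x y \<epsilon> f" "pair x' y \<epsilon> f" for x x' y
  proof -
    obtain z where z: "z \<epsilon> X x" using ne[of x] \<open>pair x y \<epsilon> f\<close> pf by blast
    have "Y x = Y x'" using that by (simp add: pf)
    then have "pair x z \<epsilon> Y x'" using z mem_Y[of x z x] by simp
    then show ?thesis by (simp add: mem_Y)
  qed
  moreover have "\<exists>x. pair x y \<epsilon> f" if "y \<epsilon> ?F" for y
    using that unfolding mem_img[OF Y] pf by blast
  ultimately have "isbij f omega ?F" unfolding isbij_def isinj_def using f by blast
  moreover have "x \<noteq> emp \<and> Fin x" if "x \<epsilon> ?F" for x
  proof -
    obtain n where n: "n \<epsilon> omega" "x = Y n" using \<open>x \<epsilon> ?F\<close> unfolding mem_img[OF Y] by blast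
    obtain z where "z \<epsilon> X n" using ne[OF n(1)] by blast
    then have "pair n z \<epsilon> x" using n(2) mem_Y by simp
    moreover have "Fin x" unfolding n(2) Y_def by (intro Fin_prd Fin_upair fin_X n(1))
    ultimately show ?thesis using not_mem_emp by blast
  qed
  ultimately obtain c U where c: "isfun c ?F U" and cm: "\<And>x y. pair x y \<epsilon> c \<Longrightarrow> y \<epsilon> x"
    using AC unfolding fin_choice_def by blast
  \<comment> \<open>The element chosen from \<open>Y n\<close> has the form \<open>pair n x\<close>;
    \<open>c'\<close> drops the tag and sends \<open>n\<close> to \<open>x\<close>.\<close>
  have "dfn (\<lambda>e. \<exists>n x. e 0 = pair n x \<and> pair (Y n) (pair n x) \<epsilon> c)"
    by (intro dfn_intros dft_fun1[OF Y])
  from separation[OF this, of "prd omega (bigcup (img X omega))"]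
  obtain c' where c': "\<And>z. z \<epsilon> c' \<longleftrightarrow> z \<epsilon> prd omega (bigcup (img X omega)) \<and>
      (\<exists>n x. z = pair n x \<and> pair (Y n) (pair n x) \<epsilon> c)" by blast
  have c'_iff: "pair n x \<epsilon> c' \<longleftrightarrow> n \<epsilon> omega \<and> pair (Y n) (pair n x) \<epsilon> c" for n x
  proof -
    have "x \<epsilon> bigcup (img X omega)" if "n \<epsilon> omega" "pair (Y n) (pair n x) \<epsilon> c"
    proof -
      have "x \<epsilon> X n" using cm[OF that(2)] by (simp add: mem_Y)
      then show ?thesis using that(1) unfolding mem_bigcup mem_img[OF X] by blast
    qed
    then show ?thesis by (simp add: c') blast
  qed
  have fun_c': "isfun c' omega (bigcup (img X omega))"
  proof (rule isfunI)
    show "sub c' (prd omega (bigcup (img X omega)))" by (simp add: c')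
    show "\<exists>x. pair n x \<epsilon> c'" if n: "n \<epsilon> omega" for n
    proof -
      obtain y where y: "pair (Y n) y \<epsilon> c" using isfun_ex[OF c YF[OF n]] by blast
      then have "y \<epsilon> Y n" by (rule cm)
      then obtain x where "y = pair n x" unfolding Y_def mem_prd by auto
      then show ?thesis using y n c'_iff by blast
    qed
    show "x = x'" if "pair n x \<epsilon> c'" "pair n x' \<epsilon> c'" for n x x'
      using isfun_unique[OF c, of "Y n" "pair n x" "pair n x'"] that by (simp add: c'_iff)
  qed
  have "app c' n \<epsilon> X n" if n: "n \<epsilon> omega" for n
  proof -
    have "pair n (app c' n) \<epsilon> c'" using pair_mem_isfun[OF fun_c' n] by blast
    then have "pair (Y n) (pair n (app c' n)) \<epsilon> c" by (simp add: c'_iff)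
    from cm[OF this] show ?thesis by (simp add: mem_Y)
  qed
  then show ?thesis by blast
qed

lemma omega_mono:
  assumes F: "dft (\<lambda>e. F (e 0))" and step: "\<And>n. n \<epsilon> omega \<Longrightarrow> sub (F n) (F (suc n))"
    and n: "n \<epsilon> omega" and m: "m \<epsilon> n"
  shows "sub (F m) (F n)"
proof -
  have "\<forall>m. m \<epsilon> n \<longrightarrow> sub (F m) (F n)"
  proof (rule omega_induct[OF n])
    show "dfn (\<lambda>e. \<forall>m. m \<epsilon> e 0 \<longrightarrow> sub (F m) (F (e 0)))"
      by (intro dfn_intros dft_fun1[OF F])
    show "\<forall>m. m \<epsilon> emp \<longrightarrow> sub (F m) (F emp)" by simp
    show "\<forall>m. m \<epsilon> suc n \<longrightarrow> sub (F m) (F (suc n))"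
      if "n \<epsilon> omega" "\<forall>m. m \<epsilon> n \<longrightarrow> sub (F m) (F n)" for n
      using step[OF that(1)] that(2) unfolding mem_suc by blast
  qed
  then show ?thesis using m by blast
qed

end


section \<open>Extending partial homomorphisms\<close>

locale finite_homs = zf_model +
  fixes V E W S
  assumes graph_V: "isgraph V E" and locfin_V: "locfin V E" and conn: "connected V E"
    and Fin_W: "Fin W"
    and finite_hom: "\<And>V' E'. isgraph V' E' \<Longrightarrow> sub V' V \<Longrightarrow> sub E' E \<Longrightarrow> Fin V' \<Longrightarrow> \<exists>f. ishom f V' E' W S"
begin

lemma edge_vertices: "upair u v \<epsilon> E \<Longrightarrow> u \<epsilon> V \<and> v \<epsilon> V"
proof -
  assume "upair u v \<epsilon> E"
  then obtain x y where xy: "x \<epsilon> V" "y \<epsilon> V" "upair u v = upair x y"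
    using graph_V unfolding isgraph_def by blast
  have "u \<epsilon> upair x y" "v \<epsilon> upair x y" unfolding xy(3)[symmetric] by simp_all
  then show ?thesis using xy(1,2) by auto
qed

text \<open>\<open>t\<close> is a homomorphism on the subgraph induced by \<open>C\<close>.\<close>

definition hom :: "'a \<Rightarrow> 'a \<Rightarrow> bool" where
  "hom t C \<longleftrightarrow> isfun t C W \<and> (\<forall>u v. u \<epsilon> C \<and> v \<epsilon> C \<and> upair u v \<epsilon> E \<longrightarrow>
     (\<exists>x y. pair u x \<epsilon> t \<and> pair v y \<epsilon> t \<and> upair x y \<epsilon> S))"

text \<open>Allowing all finite supersets, and not only the balls, makes it possible to merge
  several obstructing sets into one.\<close>

definition good :: "'a \<Rightarrow> 'a \<Rightarrow> bool" where
  "good s C \<longleftrightarrow> hom s C \<and> (\<forall>D. Fin D \<and> sub D V \<and> sub C D \<longrightarrow> (\<exists>t. hom t D \<and> sub s t))"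

lemma dfn_hom [dfn_intros]: "dft t \<Longrightarrow> dft u \<Longrightarrow> dfn (\<lambda>e. hom (t e) (u e))"
  by (rule dfn_subst2[where P = hom]; (assumption | (unfold hom_def, intro dfn_intros)))

lemma dfn_good [dfn_intros]: "dft t \<Longrightarrow> dft u \<Longrightarrow> dfn (\<lambda>e. good (t e) (u e))"
  by (rule dfn_subst2[where P = good]; (assumption | (unfold good_def, intro dfn_intros)))

lemma hom_isfun: "hom t C \<Longrightarrow> isfun t C W"
  by (simp add: hom_def)

text \<open>The assumption on finite subgraphs is applied to the subgraph induced by
  \<open>D\<close>: with all edges inside \<open>D\<close> put into \<open>E'\<close>, a
  homomorphism for \<open>E'\<close> satisfies everything that \<open>hom\<close> demands.\<close>

lemma ex_hom:
  assumes "Fin D" "sub D V"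
  shows "\<exists>t. hom t D"
proof -
  have "dfn (\<lambda>e. sub (e 0) D)" by (intro dfn_intros)
  from separation[OF this, of E] obtain E' where E': "\<And>e. e \<epsilon> E' \<longleftrightarrow> e \<epsilon> E \<and> sub e D" by blast
  have "isgraph D E'"
    unfolding isgraph_def
  proof (intro allI impI)
    fix e assume e: "e \<epsilon> E'"
    then obtain u v where uv: "u \<noteq> v" "e = upair u v"
      using graph_V unfolding isgraph_def E' by blast
    then have "u \<epsilon> D" "v \<epsilon> D" using e by (simp_all add: E')
    then show "\<exists>u v. u \<epsilon> D \<and> v \<epsilon> D \<and> u \<noteq> v \<and> e = upair u v" using uv by blast
  qed
  moreover have "sub E' E" by (simp add: E')
  ultimately obtain t where t: "ishom t D E' W S" using finite_hom assms by blast
  have "upair u v \<epsilon> E'" if "u \<epsilon> D" "v \<epsilon> D" "upair u v \<epsilon> E" for u v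
    using that by (auto simp: E')
  then have "hom t D" using t unfolding hom_def ishom_def by blast
  then show ?thesis by blast
qed

lemma hom_restrict:
  assumes t: "hom t D" and CD: "sub C D"
  shows "\<exists>r. hom r C \<and> sub r t \<and> (\<forall>x y. x \<epsilon> C \<and> pair x y \<epsilon> t \<longrightarrow> pair x y \<epsilon> r)"
proof -
  note ft = hom_isfun[OF t]
  have "dfn (\<lambda>e. \<exists>x y. x \<epsilon> C \<and> e 0 = pair x y)" by (intro dfn_intros)
  from separation[OF this, of t]
  obtain r where r: "\<And>z. z \<epsilon> r \<longleftrightarrow> z \<epsilon> t \<and> (\<exists>x y. x \<epsilon> C \<and> z = pair x y)" by blast
  have r_pair: "pair x y \<epsilon> r \<longleftrightarrow> x \<epsilon> C \<and> pair x y \<epsilon> t" for x y by (auto simp: r)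
  have "isfun r C W"
  proof (rule isfunI)
    show "sub r (prd C W)"
    proof (intro allI impI)
      fix z assume "z \<epsilon> r"
      then obtain x y where z: "x \<epsilon> C" "z = pair x y" "z \<epsilon> t" unfolding r by blast
      then show "z \<epsilon> prd C W" using isfun_memD[OF ft, of x y] by simp
    qed
    show "\<exists>y. pair x y \<epsilon> r" if "x \<epsilon> C" for x
      using isfun_ex[OF ft] CD that r_pair by blast
    show "y = z" if "pair x y \<epsilon> r" "pair x z \<epsilon> r" for x y z
      using isfun_unique[OF ft, of x y z] that by (simp add: r_pair)
  qed
  moreover have "\<exists>x y. pair u x \<epsilon> r \<and> pair v y \<epsilon> r \<and> upair x y \<epsilon> S"
    if "u \<epsilon> C" "v \<epsilon> C" "upair u v \<epsilon> E" for u v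
  proof -
    have "\<exists>x y. pair u x \<epsilon> t \<and> pair v y \<epsilon> t \<and> upair x y \<epsilon> S"
      using t that CD unfolding hom_def by blast
    then show ?thesis using that r_pair by blast
  qed
  ultimately have "hom r C" unfolding hom_def by blast
  moreover have "sub r t" by (simp add: r)
  ultimately show ?thesis using r_pair by blast
qed

text \<open>\<open>r\<close> is \<open>t\<close> restricted to \<open>C\<close>. The pairs of
  \<open>s\<close> lie over \<open>B\<close>, hence over \<open>C\<close>, and survive the
  restriction.\<close>

lemma hom_between:
  assumes s: "hom s B" and t: "hom t D" and "sub s t" "sub B C" "sub C D"
  shows "\<exists>r. hom r C \<and> sub s r \<and> sub r t"
proof -
  obtain r where r: "hom r C" "sub r t" "\<forall>x y. x \<epsilon> C \<and> pair x y \<epsilon> t \<longrightarrow> pair x y \<epsilon> r"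
    using hom_restrict[OF t assms(5)] by blast
  have "sub s r"
  proof (intro allI impI)
    fix z assume z: "z \<epsilon> s"
    then have "z \<epsilon> prd B W" using isfun_sub_prd[OF hom_isfun[OF s]] by blast
    then obtain x y where "x \<epsilon> B" "z = pair x y" unfolding mem_prd by blast
    then show "z \<epsilon> r" using z r(3) assms(3,4) by blast
  qed
  then show ?thesis using r by blast
qed

lemma Fin_homs: "Fin C \<Longrightarrow> Fin (pow (prd C W))"
  by (intro Fin_pow Fin_prd Fin_W)

text \<open>\<open>D\<close> is the union of finite supersets of \<open>C\<close>, one for each \<open>t\<close>, to which \<open>t\<close> does not extend.\<close>

lemma common_obstruction:
  assumes "Fin A" and C: "Fin C" "sub C V"
    and bad: "\<And>t. t \<epsilon> A \<Longrightarrow> hom t C \<and> \<not> good t C"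
  shows "\<exists>D. Fin D \<and> sub D V \<and> sub C D \<and> (\<forall>t r. t \<epsilon> A \<and> hom r D \<longrightarrow> \<not> sub t r)"
proof -
  have "(\<forall>t. t \<epsilon> A \<longrightarrow> hom t C \<and> \<not> good t C) \<longrightarrow>
    (\<exists>D. Fin D \<and> sub D V \<and> sub C D \<and> (\<forall>t r. t \<epsilon> A \<and> hom r D \<longrightarrow> \<not> sub t r))"
  proof (rule Fin_induct[OF assms(1)])
    show "dfn (\<lambda>e. (\<forall>t. t \<epsilon> e 0 \<longrightarrow> hom t C \<and> \<not> good t C) \<longrightarrow>
      (\<exists>D. Fin D \<and> sub D V \<and> sub C D \<and> (\<forall>t r. t \<epsilon> e 0 \<and> hom r D \<longrightarrow> \<not> sub t r)))"
      by (intro dfn_intros)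
    show "(\<forall>t. t \<epsilon> emp \<longrightarrow> hom t C \<and> \<not> good t C) \<longrightarrow>
      (\<exists>D. Fin D \<and> sub D V \<and> sub C D \<and> (\<forall>t r. t \<epsilon> emp \<and> hom r D \<longrightarrow> \<not> sub t r))"
      using C by (intro impI exI[of _ C]) simp
    fix a A
    assume IH: "(\<forall>t. t \<epsilon> A \<longrightarrow> hom t C \<and> \<not> good t C) \<longrightarrow>
      (\<exists>D. Fin D \<and> sub D V \<and> sub C D \<and> (\<forall>t r. t \<epsilon> A \<and> hom r D \<longrightarrow> \<not> sub t r))"
    show "(\<forall>t. t \<epsilon> ins a A \<longrightarrow> hom t C \<and> \<not> good t C) \<longrightarrow>
      (\<exists>D. Fin D \<and> sub D V \<and> sub C D \<and> (\<forall>t r. t \<epsilon> ins a A \<and> hom r D \<longrightarrow> \<not> sub t r))"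
    proof
      assume *: "\<forall>t. t \<epsilon> ins a A \<longrightarrow> hom t C \<and> \<not> good t C"
      have all: "hom t C \<and> \<not> good t C" if "t \<epsilon> A \<or> t = a" for t
        using *[rule_format, of t] that by simp
      have "\<forall>t. t \<epsilon> A \<longrightarrow> hom t C \<and> \<not> good t C" using all by blast
      from IH[THEN mp, OF this] obtain D1 where D1: "Fin D1" "sub D1 V" "sub C D1"
        and no1: "\<And>t r. t \<epsilon> A \<Longrightarrow> hom r D1 \<Longrightarrow> \<not> sub t r" by blast
      have "hom a C" "\<not> good a C" using all by blast+
      then obtain D2 where D2: "Fin D2" "sub D2 V" "sub C D2"
        and no2: "\<And>r. hom r D2 \<Longrightarrow> \<not> sub a r" unfolding good_def by blast
      let ?D = "cup D1 D2"
      \<comment> \<open>An extension of \<open>t\<close> to the union would restrict to both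
        \<open>D1\<close> and \<open>D2\<close>; \<open>D1\<close> excludes this for members of
        \<open>A\<close>, and \<open>D2\<close> for \<open>a\<close>.\<close>
      have no: "\<not> sub t r" if t: "t \<epsilon> A \<or> t = a" and r: "hom r ?D" for t r
      proof
        assume tr: "sub t r"
        have t_hom: "hom t C" using all[OF t] by simp
        have "\<exists>r'. hom r' D1 \<and> sub t r' \<and> sub r' r"
          by (rule hom_between[OF t_hom r tr D1(3)]) simp
        moreover have "\<exists>r'. hom r' D2 \<and> sub t r' \<and> sub r' r"
          by (rule hom_between[OF t_hom r tr D2(3)]) simp
        ultimately show False using no1 no2 t by blast
      qed
      have "Fin ?D" by (rule Fin_cup[OF D1(1) D2(1)])
      moreover have "sub ?D V" using D1(2) D2(2) by simp
      moreover have "sub C ?D" using D1(3) by simp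
      moreover have "\<forall>t r. t \<epsilon> ins a A \<and> hom r ?D \<longrightarrow> \<not> sub t r"
        unfolding mem_ins using no by blast
      ultimately show "\<exists>D. Fin D \<and> sub D V \<and> sub C D \<and> (\<forall>t r. t \<epsilon> ins a A \<and> hom r D \<longrightarrow> \<not> sub t r)"
        by blast
    qed
  qed
  then show ?thesis using bad by blast
qed

text \<open>If no extension of \<open>s\<close> to \<open>C\<close> were good, then, there being
  finitely many, a single finite \<open>D\<close> would defeat them all. But \<open>s\<close> is
  good and extends to \<open>D\<close>, and that map restricted to \<open>C\<close> is one of the
  defeated extensions.\<close>

lemma good_extend:
  assumes s: "good s B" and BC: "sub B C" and C: "Fin C" "sub C V"
  shows "\<exists>t. good t C \<and> sub s t"
proof (rule ccontr)
  assume *: "\<not> (\<exists>t. good t C \<and> sub s t)"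
  have "dfn (\<lambda>e. hom (e 0) C \<and> sub s (e 0))" by (intro dfn_intros)
  from separation[OF this, of "pow (prd C W)"]
  obtain A where A: "\<And>t. t \<epsilon> A \<longleftrightarrow> t \<epsilon> pow (prd C W) \<and> hom t C \<and> sub s t" by blast
  have "Fin A" by (rule Fin_subset[OF Fin_homs[OF C(1)]]) (simp add: A)
  moreover have "hom t C \<and> \<not> good t C" if "t \<epsilon> A" for t
    using * \<open>t \<epsilon> A\<close> unfolding A by blast
  ultimately obtain D where D: "Fin D" "sub D V" "sub C D"
    and no: "\<And>t r. t \<epsilon> A \<Longrightarrow> hom r D \<Longrightarrow> \<not> sub t r" using common_obstruction[OF _ C, of A] by blast
  have "sub B D" using BC D(3) by blast
  then obtain r where r: "hom r D" "sub s r" using s D unfolding good_def by blast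
  have "hom s B" using s by (simp add: good_def)
  from hom_between[OF this r BC D(3)] obtain t where t: "hom t C" "sub s t" "sub t r" by blast
  have "t \<epsilon> A" using t isfun_sub_prd[OF hom_isfun[OF t(1)]] by (simp add: A)
  then show False using no r(1) t(3) by blast
qed

text \<open>Here the assumption on finite subgraphs enters: for the empty map, goodness says that
  each finite set of vertices carries a homomorphism.\<close>

lemma good_emp: "good emp emp"
proof -
  have "hom emp emp" by (simp add: hom_def isfun_def)
  then show ?thesis using ex_hom by (simp add: good_def)
qed

section \<open>Balls around a vertex\<close>

text \<open>The closed neighbourhood of \<open>b\<close> together with the centre \<open>v0\<close>, so that iteration from
  the empty set yields the balls around \<open>v0\<close>.\<close>

definition nbh :: "'a \<Rightarrow> 'a \<Rightarrow> 'a" where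
  "nbh v0 b = setof (\<lambda>y. y \<epsilon> V \<and> (y \<epsilon> b \<or> y = v0 \<or> (\<exists>x. x \<epsilon> b \<and> upair x y \<epsilon> E)))"

lemma mem_nbh: "y \<epsilon> nbh v0 b \<longleftrightarrow> y \<epsilon> V \<and> (y \<epsilon> b \<or> y = v0 \<or> (\<exists>x. x \<epsilon> b \<and> upair x y \<epsilon> E))"
  unfolding nbh_def by (rule mem_setof[OF separation]) (intro dfn_intros)

lemma dft_nbh [dfn_intros]: "dft t \<Longrightarrow> dft (\<lambda>e. nbh v0 (t e))"
  by (rule dft_fun1[where F = "nbh v0"]; (assumption | (rule dft_set, rule mem_nbh, intro dfn_intros)))

text \<open>Degrees count edges, so neighbours are reached through edges: \<open>bigcup N\<close> is
  finite and covers all neighbours of \<open>b\<close>. No choice is made, since the set of edges at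
  a vertex is determined by the vertex.\<close>

lemma finitely_many_edges:
  assumes "Fin b" "sub b V"
  shows "\<exists>N. Fin N \<and> (\<forall>e. e \<epsilon> N \<longrightarrow> Fin e) \<and> (\<forall>e x. e \<epsilon> E \<and> x \<epsilon> b \<and> x \<epsilon> e \<longrightarrow> e \<epsilon> N)"
proof -
  have "sub b V \<longrightarrow>
    (\<exists>N. Fin N \<and> (\<forall>e. e \<epsilon> N \<longrightarrow> Fin e) \<and> (\<forall>e x. e \<epsilon> E \<and> x \<epsilon> b \<and> x \<epsilon> e \<longrightarrow> e \<epsilon> N))"
  proof (rule Fin_induct[OF assms(1)])
    show "dfn (\<lambda>e. sub (e 0) V \<longrightarrow>
      (\<exists>N. Fin N \<and> (\<forall>e. e \<epsilon> N \<longrightarrow> Fin e) \<and> (\<forall>d x. d \<epsilon> E \<and> x \<epsilon> e 0 \<and> x \<epsilon> d \<longrightarrow> d \<epsilon> N)))"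
      by (intro dfn_intros)
    show "sub emp V \<longrightarrow>
      (\<exists>N. Fin N \<and> (\<forall>e. e \<epsilon> N \<longrightarrow> Fin e) \<and> (\<forall>e x. e \<epsilon> E \<and> x \<epsilon> emp \<and> x \<epsilon> e \<longrightarrow> e \<epsilon> N))"
      using Fin_emp by (intro impI exI[of _ emp]) simp
    fix a b
    assume IH: "sub b V \<longrightarrow>
      (\<exists>N. Fin N \<and> (\<forall>e. e \<epsilon> N \<longrightarrow> Fin e) \<and> (\<forall>e x. e \<epsilon> E \<and> x \<epsilon> b \<and> x \<epsilon> e \<longrightarrow> e \<epsilon> N))"
    show "sub (ins a b) V \<longrightarrow>
      (\<exists>N. Fin N \<and> (\<forall>e. e \<epsilon> N \<longrightarrow> Fin e) \<and> (\<forall>e x. e \<epsilon> E \<and> x \<epsilon> ins a b \<and> x \<epsilon> e \<longrightarrow> e \<epsilon> N))"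
    proof
      assume "sub (ins a b) V"
      then have aV: "a \<epsilon> V" and "sub b V" by simp_all
      then obtain N where N: "Fin N" "\<forall>e. e \<epsilon> N \<longrightarrow> Fin e"
        "\<forall>e x. e \<epsilon> E \<and> x \<epsilon> b \<and> x \<epsilon> e \<longrightarrow> e \<epsilon> N" using IH by blast
      obtain D where D: "\<And>e. e \<epsilon> D \<longleftrightarrow> e \<epsilon> E \<and> a \<epsilon> e" "Fin D"
        using locfin_V aV unfolding locfin_def by blast
      have "Fin e" if "e \<epsilon> D" for e
      proof -
        obtain u v where "e = upair u v"
          using graph_V \<open>e \<epsilon> D\<close> unfolding isgraph_def D(1) by blast
        then show ?thesis using Fin_upair by simp
      qed
      then have "Fin (cup N D) \<and> (\<forall>e. e \<epsilon> cup N D \<longrightarrow> Fin e) \<and>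
          (\<forall>e x. e \<epsilon> E \<and> x \<epsilon> ins a b \<and> x \<epsilon> e \<longrightarrow> e \<epsilon> cup N D)"
        unfolding mem_cup mem_ins using Fin_cup[OF N(1) D(2)] N(2,3) D(1) by blast
      then show "\<exists>N. Fin N \<and> (\<forall>e. e \<epsilon> N \<longrightarrow> Fin e) \<and>
          (\<forall>e x. e \<epsilon> E \<and> x \<epsilon> ins a b \<and> x \<epsilon> e \<longrightarrow> e \<epsilon> N)" by blast
    qed
  qed
  then show ?thesis using assms(2) by blast
qed

lemma Fin_nbh:
  assumes "Fin b" "sub b V"
  shows "Fin (nbh v0 b)"
proof -
  obtain N where N: "Fin N" "\<And>e. e \<epsilon> N \<Longrightarrow> Fin e"
    "\<And>e x. e \<epsilon> E \<Longrightarrow> x \<epsilon> b \<Longrightarrow> x \<epsilon> e \<Longrightarrow> e \<epsilon> N" using finitely_many_edges[OF assms] by blast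
  have "Fin (ins v0 (cup b (bigcup N)))" by (intro Fin_ins Fin_cup Fin_bigcup assms(1) N(1,2))
  moreover have "sub (nbh v0 b) (ins v0 (cup b (bigcup N)))"
  proof (intro allI impI)
    fix y assume y: "y \<epsilon> nbh v0 b"
    have "y \<epsilon> bigcup N" if "x \<epsilon> b" "upair x y \<epsilon> E" for x
    proof -
      have "upair x y \<epsilon> N" using N(3)[OF that(2,1)] by simp
      then show ?thesis unfolding mem_bigcup by (intro exI[of _ "upair x y"]) simp
    qed
    then show "y \<epsilon> ins v0 (cup b (bigcup N))" using y unfolding mem_nbh mem_ins mem_cup by blast
  qed
  ultimately show ?thesis by (rule Fin_subset)
qed

lemma ex_exhaustion:
  assumes v0: "v0 \<epsilon> V"
  shows "\<exists>b. app b emp = emp \<and>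
    (\<forall>n. n \<epsilon> omega \<longrightarrow> Fin (app b n) \<and> sub (app b n) V \<and> sub (app b n) (app b (suc n))) \<and>
    (\<forall>v. v \<epsilon> V \<longrightarrow> (\<exists>n. n \<epsilon> omega \<and> v \<epsilon> app b n))"
proof -
  have "dft (\<lambda>e. nbh v0 (e 1))" by (intro dfn_intros)
  moreover have "emp \<epsilon> pow V" by simp
  moreover have "nbh v0 x \<epsilon> pow V" for x by (simp add: mem_nbh)
  ultimately have "\<exists>b. isfun b omega (pow V) \<and> app b emp = emp \<and>
      (\<forall>n. n \<epsilon> omega \<longrightarrow> app b (suc n) = nbh v0 (app b n))"
    by (intro recursion[where G = "\<lambda>_. nbh v0"])
  then obtain b where b: "isfun b omega (pow V)" and b0: "app b emp = emp"
    and bs: "\<And>n. n \<epsilon> omega \<Longrightarrow> app b (suc n) = nbh v0 (app b n)" by blast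
  have bV: "sub (app b n) V" if "n \<epsilon> omega" for n using app_mem[OF b that] by simp
  have "Fin (app b n)" if "n \<epsilon> omega" for n
  proof (rule omega_induct[OF that])
    show "dfn (\<lambda>e. Fin (app b (e 0)))" by (intro dfn_intros)
    show "Fin (app b emp)" using Fin_emp by (simp add: b0)
    show "Fin (app b (suc n))" if "n \<epsilon> omega" "Fin (app b n)" for n
      unfolding bs[OF that(1)] by (rule Fin_nbh[OF that(2) bV[OF that(1)]])
  qed
  moreover have "sub (app b n) (app b (suc n))" if "n \<epsilon> omega" for n
    using bV[OF that] by (simp add: bs[OF that] mem_nbh)
  moreover have "\<exists>n. n \<epsilon> omega \<and> v \<epsilon> app b n" if v: "v \<epsilon> V" for v
  proof -
    obtain n p where n: "n \<epsilon> omega" and path: "ispath V E p n v0 v"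
      using conn v0 v unfolding connected_def by blast
    have p: "isfun p (suc n) V" and p0: "pair emp v0 \<epsilon> p" and pn: "pair n v \<epsilon> p"
      and edge: "\<And>i. i \<epsilon> n \<Longrightarrow> \<exists>x y. pair i x \<epsilon> p \<and> pair (suc i) y \<epsilon> p \<and> upair x y \<epsilon> E"
      using path by (simp_all add: ispath_def isinj_def)
    \<comment> \<open>The i-th vertex of the path lies in the ball with index \<open>suc i\<close>,
      because \<open>app b emp\<close> is empty. The induction runs over all of
      \<open>omega\<close>, hence the guard \<open>i \<epsilon> suc n\<close>.\<close>
    have "i \<epsilon> suc n \<longrightarrow> (\<forall>x. pair i x \<epsilon> p \<longrightarrow> x \<epsilon> app b (suc i))" if "i \<epsilon> omega" for i
    proof (rule omega_induct[OF that])
      show "dfn (\<lambda>e. e 0 \<epsilon> suc n \<longrightarrow> (\<forall>x. pair (e 0) x \<epsilon> p \<longrightarrow> x \<epsilon> app b (suc (e 0))))"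
        by (intro dfn_intros)
      have "x \<epsilon> app b (suc emp)" if "pair emp x \<epsilon> p" for x
      proof -
        have "x = v0" by (rule isfun_unique[OF p that p0])
        then show ?thesis using v0 by (simp add: bs mem_nbh)
      qed
      then show "emp \<epsilon> suc n \<longrightarrow> (\<forall>x. pair emp x \<epsilon> p \<longrightarrow> x \<epsilon> app b (suc emp))" by blast
      fix i
      assume i: "i \<epsilon> omega" and IH: "i \<epsilon> suc n \<longrightarrow> (\<forall>x. pair i x \<epsilon> p \<longrightarrow> x \<epsilon> app b (suc i))"
      show "suc i \<epsilon> suc n \<longrightarrow> (\<forall>x. pair (suc i) x \<epsilon> p \<longrightarrow> x \<epsilon> app b (suc (suc i)))"
      proof (intro impI allI)
        fix x assume si: "suc i \<epsilon> suc n" and x: "pair (suc i) x \<epsilon> p"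
        have "i \<epsilon> suc i" by (simp add: mem_suc)
        then have "i \<epsilon> n" using si omega_trans[OF n, of "suc i" i] unfolding mem_suc[of "suc i" n] by blast
        then obtain x' y where xy: "pair i x' \<epsilon> p" "pair (suc i) y \<epsilon> p" "upair x' y \<epsilon> E"
          using edge by blast
        have "y = x" by (rule isfun_unique[OF p xy(2) x])
        then have "upair x' x \<epsilon> E" using xy(3) by simp
        moreover have "x' \<epsilon> app b (suc i)" using IH \<open>i \<epsilon> n\<close> xy(1) by (simp add: mem_suc)
        ultimately show "x \<epsilon> app b (suc (suc i))"
          using edge_vertices[of x' x] unfolding bs[OF suc_omega[OF i]] mem_nbh by blast
      qed
    qed
    then have "v \<epsilon> app b (suc n)" using n pn by (simp add: mem_suc)
    then show ?thesis using suc_omega[OF n] by blast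
  qed
  ultimately show ?thesis using b0 bV by blast
qed

section \<open>The global homomorphism\<close>

text \<open>The empty start matters: the chain begins with \<open>good_emp\<close>, and each chosen
  function maps good homomorphisms on one set to good extensions on the next, so plain recursion
  does the rest.\<close>

lemma ex_good_chain:
  assumes AC: fin_choice and b0: "app b emp = emp"
    and Fin_b: "\<And>n. n \<epsilon> omega \<Longrightarrow> Fin (app b n)" and bV: "\<And>n. n \<epsilon> omega \<Longrightarrow> sub (app b n) V"
    and b_mono: "\<And>n. n \<epsilon> omega \<Longrightarrow> sub (app b n) (app b (suc n))"
  shows "\<exists>r. \<forall>n. n \<epsilon> omega \<longrightarrow> good (app r n) (app b n) \<and> sub (app r n) (app r (suc n))"
proof -
  define Gd where "Gd n = setof (\<lambda>s. s \<epsilon> pow (prd (app b n) W) \<and> good s (app b n))" for n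
  have mem_Gd': "s \<epsilon> Gd n \<longleftrightarrow> s \<epsilon> pow (prd (app b n) W) \<and> good s (app b n)" for s n
    unfolding Gd_def by (rule mem_setof[OF separation]) (intro dfn_intros)
  have mem_Gd: "s \<epsilon> Gd n \<longleftrightarrow> good s (app b n)" for s n
  proof -
    have "sub s (prd (app b n) W)" if "good s (app b n)"
      using that by (intro isfun_sub_prd hom_isfun) (simp add: good_def)
    then show ?thesis unfolding mem_Gd' mem_pow by blast
  qed
  have Gd: "dft (\<lambda>e. Gd (e 0))" by (rule dft_set, rule mem_Gd, intro dfn_intros)
  have Fin_Gd: "Fin (Gd n)" if "n \<epsilon> omega" for n
    by (rule Fin_subset[OF Fin_homs[OF Fin_b[OF that]]]) (simp add: mem_Gd')
  define \<Phi> where "\<Phi> n = setof (\<lambda>\<phi>. \<phi> \<epsilon> pow (prd (Gd n) (Gd (suc n))) \<and>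
      isfun \<phi> (Gd n) (Gd (suc n)) \<and> (\<forall>s t. pair s t \<epsilon> \<phi> \<longrightarrow> sub s t))" for n
  have mem_\<Phi>: "\<phi> \<epsilon> \<Phi> n \<longleftrightarrow> \<phi> \<epsilon> pow (prd (Gd n) (Gd (suc n))) \<and>
      isfun \<phi> (Gd n) (Gd (suc n)) \<and> (\<forall>s t. pair s t \<epsilon> \<phi> \<longrightarrow> sub s t)" for \<phi> n
    unfolding \<Phi>_def by (rule mem_setof[OF separation]) (intro dfn_intros)
  have \<Phi>: "dft (\<lambda>e. \<Phi> (e 0))" by (rule dft_set, rule mem_\<Phi>, intro dfn_intros dft_fun1[OF Gd])
  have Fin_\<Phi>: "Fin (\<Phi> n)" if "n \<epsilon> omega" for n
    by (rule Fin_subset[OF Fin_pow[OF Fin_prd[OF Fin_Gd[OF that] Fin_Gd[OF suc_omega[OF that]]]]])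
      (simp add: mem_\<Phi>)
  have ne: "\<exists>\<phi>. \<phi> \<epsilon> \<Phi> n" if n: "n \<epsilon> omega" for n
  proof -
    have "\<exists>t. t \<epsilon> Gd (suc n) \<and> sub s t" if "s \<epsilon> Gd n" for s
      using good_extend[OF _ b_mono[OF n] Fin_b[OF suc_omega[OF n]] bV[OF suc_omega[OF n]], of s] that
      unfolding mem_Gd by blast
    moreover have "dfn (\<lambda>e. sub (e 0) (e 1))" by (intro dfn_intros)
    ultimately obtain \<phi> where \<phi>: "isfun \<phi> (Gd n) (Gd (suc n))" "\<forall>s t. pair s t \<epsilon> \<phi> \<longrightarrow> sub s t"
      using finite_choice[OF Fin_Gd[OF n], of sub "Gd (suc n)"] by blast
    then show ?thesis using isfun_sub_prd[OF \<phi>(1)] unfolding mem_\<Phi> mem_pow by blast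
  qed
  obtain c where c: "\<And>n. n \<epsilon> omega \<Longrightarrow> app c n \<epsilon> \<Phi> n"
    using choice_sequence[OF AC \<Phi> Fin_\<Phi> ne] by blast
  have c_fun: "isfun (app c n) (Gd n) (Gd (suc n))"
    and c_ext: "\<And>s t. pair s t \<epsilon> app c n \<Longrightarrow> sub s t" if "n \<epsilon> omega" for n
    using c[OF that] unfolding mem_\<Phi> by blast+
  have "dft (\<lambda>e. app (app c (e 0)) (e 1))" by (intro dfn_intros)
  moreover have "emp \<epsilon> pow (prd V W)" by simp
  \<comment> \<open>\<open>recursion\<close> asks for a value in one fixed set for each
    \<open>x\<close>, good or not. Outside \<open>Gd n\<close> the value is the junk value
    \<open>emp\<close>, which lies in \<open>pow (prd V W)\<close>.\<close>
  moreover have "app (app c n) x \<epsilon> pow (prd V W)" if n: "n \<epsilon> omega" for n x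
  proof (cases "x \<epsilon> Gd n")
    case True
    then have "good (app (app c n) x) (app b (suc n))"
      using app_mem[OF c_fun[OF n]] by (simp add: mem_Gd)
    then have "sub (app (app c n) x) (prd (app b (suc n)) W)"
      by (intro isfun_sub_prd hom_isfun) (simp add: good_def)
    then show ?thesis using bV[OF suc_omega[OF n]] unfolding mem_pow mem_prd by blast
  next
    case False
    have "\<not> pair x y \<epsilon> app c n" for y using isfun_memD[OF c_fun[OF n], of x y] False by blast
    then have "\<not> u \<epsilon> app (app c n) x" for u by (simp add: mem_app) blast
    then show ?thesis by simp
  qed
  ultimately have "\<exists>r. isfun r omega (pow (prd V W)) \<and> app r emp = emp \<and>
      (\<forall>n. n \<epsilon> omega \<longrightarrow> app r (suc n) = app (app c n) (app r n))"
    by (intro recursion[where G = "\<lambda>n. app (app c n)"])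
  then obtain r where r0: "app r emp = emp"
    and rs: "\<And>n. n \<epsilon> omega \<Longrightarrow> app r (suc n) = app (app c n) (app r n)" by blast
  have rG: "app r n \<epsilon> Gd n" if "n \<epsilon> omega" for n
  proof (rule omega_induct[OF that])
    show "dfn (\<lambda>e. app r (e 0) \<epsilon> Gd (e 0))" by (intro dfn_intros dft_fun1[OF Gd])
    show "app r emp \<epsilon> Gd emp" using good_emp by (simp add: mem_Gd r0 b0)
    show "app r (suc n) \<epsilon> Gd (suc n)" if "n \<epsilon> omega" "app r n \<epsilon> Gd n" for n
      unfolding rs[OF that(1)] by (rule app_mem[OF c_fun[OF that(1)] that(2)])
  qed
  have "sub (app r n) (app r (suc n))" if n: "n \<epsilon> omega" for n
    using c_ext[OF n, of "app r n" "app r (suc n)"] pair_mem_isfun[OF c_fun[OF n] rG[OF n]] rs[OF n]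
    by blast
  then show ?thesis using rG unfolding mem_Gd by blast
qed

text \<open>The map is the union of the chain. By \<open>omega_linear\<close>, any two of its pairs,
  and the two ends of any edge, occur at a common index, where functionality and preservation of
  edges are known.\<close>

theorem ex_global_hom:
  assumes AC: fin_choice and ne: "v0 \<epsilon> V"
  shows "\<exists>f. ishom f V E W S"
proof -
  obtain b where b0: "app b emp = emp"
    and Fin_b: "\<And>n. n \<epsilon> omega \<Longrightarrow> Fin (app b n)" and bV: "\<And>n. n \<epsilon> omega \<Longrightarrow> sub (app b n) V"
    and b_mono: "\<And>n. n \<epsilon> omega \<Longrightarrow> sub (app b n) (app b (suc n))"
    and cover: "\<And>v. v \<epsilon> V \<Longrightarrow> \<exists>n. n \<epsilon> omega \<and> v \<epsilon> app b n"
    using ex_exhaustion[OF ne] by blast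
  obtain r where good_r: "\<And>n. n \<epsilon> omega \<Longrightarrow> good (app r n) (app b n)"
    and r_mono: "\<And>n. n \<epsilon> omega \<Longrightarrow> sub (app r n) (app r (suc n))"
    using ex_good_chain[OF AC b0 Fin_b bV b_mono] by blast
  have hom_r: "hom (app r n) (app b n)" if "n \<epsilon> omega" for n
    using good_r[OF that] by (simp add: good_def)
  note fun_r = hom_isfun[OF hom_r]
  have r_sub: "sub (app r m) (app r n)" and b_sub: "sub (app b m) (app b n)"
    if "n \<epsilon> omega" "m \<epsilon> n" for m n
    by (rule omega_mono[where F = "app r"] omega_mono[where F = "app b"];
        (fact r_mono b_mono that | intro dfn_intros))+
  have directed: "\<exists>k. k \<epsilon> omega \<and> sub (app r m) (app r k) \<and> sub (app r n) (app r k) \<and>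
      sub (app b m) (app b k) \<and> sub (app b n) (app b k)"
    if m: "m \<epsilon> omega" and n: "n \<epsilon> omega" for m n
    using omega_linear[OF m n]
  proof (elim disjE)
    assume "m \<epsilon> n" then show ?thesis using r_sub[OF n] b_sub[OF n] n by blast
  next
    assume "m = n" then show ?thesis using n by blast
  next
    assume "n \<epsilon> m" then show ?thesis using r_sub[OF m] b_sub[OF m] m by blast
  qed
  have "dfn (\<lambda>e. \<exists>n. n \<epsilon> omega \<and> e 0 \<epsilon> app r n)" by (intro dfn_intros)
  from separation[OF this, of "prd V W"]
  obtain f where f: "\<And>z. z \<epsilon> f \<longleftrightarrow> z \<epsilon> prd V W \<and> (\<exists>n. n \<epsilon> omega \<and> z \<epsilon> app r n)" by blast
  have f_pair: "pair x y \<epsilon> f \<longleftrightarrow> (\<exists>n. n \<epsilon> omega \<and> pair x y \<epsilon> app r n)" for x y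
  proof -
    have "pair x y \<epsilon> prd V W" if n: "n \<epsilon> omega" "pair x y \<epsilon> app r n" for n
      using isfun_memD[OF fun_r[OF n(1)] n(2)] bV[OF n(1)] by simp
    then show ?thesis unfolding f by blast
  qed
  have "isfun f V W"
  proof (rule isfunI)
    show "sub f (prd V W)" by (simp add: f)
    show "\<exists>y. pair x y \<epsilon> f" if x: "x \<epsilon> V" for x
    proof -
      obtain n where n: "n \<epsilon> omega" "x \<epsilon> app b n" using cover[OF x] by blast
      then show ?thesis using isfun_ex[OF fun_r[OF n(1)] n(2)] unfolding f_pair by blast
    qed
    show "y = z" if y: "pair x y \<epsilon> f" and z: "pair x z \<epsilon> f" for x y z
    proof -
      obtain m n where m: "m \<epsilon> omega" "pair x y \<epsilon> app r m" and n: "n \<epsilon> omega" "pair x z \<epsilon> app r n"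
        using y z unfolding f_pair by blast
      obtain k where k: "k \<epsilon> omega" "sub (app r m) (app r k)" "sub (app r n) (app r k)"
        using directed[OF m(1) n(1)] by blast
      show ?thesis using isfun_unique[OF fun_r[OF k(1)], of x y z] k(2,3) m(2) n(2) by blast
    qed
  qed
  moreover have "\<exists>x y. pair u x \<epsilon> f \<and> pair v y \<epsilon> f \<and> upair x y \<epsilon> S" if uv: "upair u v \<epsilon> E" for u v
  proof -
    obtain m n where m: "m \<epsilon> omega" "u \<epsilon> app b m" and n: "n \<epsilon> omega" "v \<epsilon> app b n"
      using cover edge_vertices[OF uv] by blast
    obtain k where k: "k \<epsilon> omega" "sub (app b m) (app b k)" "sub (app b n) (app b k)"
      using directed[OF m(1) n(1)] by blast
    have "u \<epsilon> app b k" "v \<epsilon> app b k" using k(2,3) m(2) n(2) by blast+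
    then have "\<exists>x y. pair u x \<epsilon> app r k \<and> pair v y \<epsilon> app r k \<and> upair x y \<epsilon> S"
      using hom_r[OF k(1)] uv unfolding hom_def by blast
    then show ?thesis using k(1) unfolding f_pair by blast
  qed
  ultimately show ?thesis unfolding ishom_def by blast
qed

end

theorem proposition3p7:
  "ZF \<turnstile>
    (AC_fin_omega \<^bold>\<longrightarrow>
      (\<^bold>\<forall>V\<^sub>G E\<^sub>G V\<^sub>H E\<^sub>H.
        graph V\<^sub>G E\<^sub>G \<^bold>\<and> \<^bold>\<not> fin V\<^sub>G \<^bold>\<and> locally_finite V\<^sub>G E\<^sub>G \<^bold>\<and> connected_graph V\<^sub>G E\<^sub>G \<^bold>\<and>
        graph V\<^sub>H E\<^sub>H \<^bold>\<and> fin V\<^sub>H \<^bold>\<and>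
        (\<^bold>\<forall>V E. subgraph V E V\<^sub>G E\<^sub>G \<^bold>\<and> fin V \<^bold>\<longrightarrow> (\<^bold>\<exists>f. is_hom f V E V\<^sub>H E\<^sub>H)) \<^bold>\<longrightarrow>
        (\<^bold>\<exists>f. is_hom f V\<^sub>G E\<^sub>G V\<^sub>H E\<^sub>H))) 0"
proof (rule completeness)
  show "\<exists>x. \<forall>y\<in>D. \<not> Q x y"
    if "congruence R Q" "\<And>q e. q \<in> ZF \<Longrightarrow> sat R Q e q" "finite D" for R Q :: "nat \<Rightarrow> nat \<Rightarrow> bool" and D
    using that by (rule ZF_prestructure_infinite)
next
  fix R :: "nat \<Rightarrow> nat \<Rightarrow> bool" and e
  assume ZF: "\<And>q e. q \<in> ZF \<Longrightarrow> sat R (=) e q"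
  interpret zf_model R by unfold_locales (rule ZF)
  \<comment> \<open>The content of the sentence after evaluation in the model by the
    \<open>holds\<close> rules.\<close>
  have "\<exists>f. ishom f V E W S"
    if AC: fin_choice and V: "isgraph V E" "\<not> Fin V" "locfin V E" "connected V E" and W: "Fin W"
      and homs: "\<And>V' E'. isgraph V' E' \<Longrightarrow> sub V' V \<Longrightarrow> sub E' E \<Longrightarrow> Fin V' \<Longrightarrow> \<exists>f. ishom f V' E' W S"
    for V E W S
  proof -
    interpret finite_homs R V E W S by unfold_locales (fact V(1,3,4) W homs)+
    \<comment> \<open>The empty set is finite and \<open>V\<close> is not, so there is a vertex to
      serve as the centre of the balls.\<close>
    obtain v where "R v V" using V(2) Fin_emp eq_emp_iff by metis
    then show ?thesis by (rule ex_global_hom[OF AC])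
  qed
  then show "sat R (=) e ((AC_fin_omega \<^bold>\<longrightarrow>
      (\<^bold>\<forall>V\<^sub>G E\<^sub>G V\<^sub>H E\<^sub>H.
        graph V\<^sub>G E\<^sub>G \<^bold>\<and> \<^bold>\<not> fin V\<^sub>G \<^bold>\<and> locally_finite V\<^sub>G E\<^sub>G \<^bold>\<and> connected_graph V\<^sub>G E\<^sub>G \<^bold>\<and>
        graph V\<^sub>H E\<^sub>H \<^bold>\<and> fin V\<^sub>H \<^bold>\<and>
        (\<^bold>\<forall>V E. subgraph V E V\<^sub>G E\<^sub>G \<^bold>\<and> fin V \<^bold>\<longrightarrow> (\<^bold>\<exists>f. is_hom f V E V\<^sub>H E\<^sub>H)) \<^bold>\<longrightarrow>
        (\<^bold>\<exists>f. is_hom f V\<^sub>G E\<^sub>G V\<^sub>H E\<^sub>H))) 0)"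
    by simp
qed

end
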